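(* Let $\Psi$ be a rigid complement map on $V^*$, let $P$ be a $\Psi$-generic rational polytope in $V$, and let $h(x)$ be a polynomial function on $V$. For each face $F$ of $P$ let $D^{\Psi}(P,F)=\mu^{\Psi}(\mathrm{Supp}(P,F))(\partial_x)$ be the infinite-order constant-coefficient differential operator obtained from the Taylor series of $\mu^\Psi(\mathrm{Supp}(P,F))$ at $\xi=0$. Then $$\sum_{x\in P\cap\Lambda}h(x)=\sum_{F\in\mathcal F(P)}\int_F D^{\Psi}(P,F)\cdot h .$$ In particular, taking $h=1$, $$\#(P)=\sum_{F\in\mathcal F(P)}\mu^{\Psi}(\mathrm{Supp}(P,F))(0)\,\mathrm{vol}(F),$$ where $\#(P)$ is the number of lattice points of $P$ and $\mathrm{vol}(F)$ is the volume of $F$.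
   Context: Basic setting. $\Lambda\cong\mathbb Z^n$ is a lattice, $V=\Lambda\otimes_{\mathbb Z}\mathbb Q$, $V^*=\mathrm{Hom}_{\mathbb Q}(V,\mathbb Q)$ with pairing $\langle\cdot,\cdot\rangle$. $\mathcal M(V^* )$ is the algebra of meromorphic functions on $V^*_{\mathbb C}=V^*\otimes\mathbb C$. A rational quotient $W$ of $V$ carries the image lattice, and $W^*$ is regarded as a subspace of $V^*$. Polyhedra are nonempty subsets of $V$ cut out by finitely many affine inequalities with rational coefficients; a polytope is a bounded polyhedron; a cone is a polyhedron $s+C$ with $s\in V$ and $C$ a rational polyhedral convex cone with apex $0$. $\mathcal F(P)$ is the set of nonempty faces of $P$ (including $P$). $\mathrm{aff}(F)$ is the affine span of $F$, $\mathrm{lin}(F)$ the parallel linear subspace. For a face $F$ of $P$ and $x$ in the relative interior of $F$, $\mathrm{Tan}(P,F)=\{v\in V: x+\epsilon v\in P\text{ for small }\epsilon>0\}$ and $\mathrm{Supp}(P,F)=x+\mathrm{Tan}(P,F)$. Integrals and volumes over $P$ (or $F$) are over the corresponding real polyhedron, with respect to Lebesgue measure on its affine span normalized so that a basis of $\Lambda\cap \mathrm{lin}(P)$ spans a parallelepiped of volume $1$ (unit mass for a point). Exponential sums and integrals. For a polyhedron $P$, $S(P),I(P)\in\mathcal M(V^* )$ are the functions (which exist by a theorem of Lawrence) determined by: $S(P)=I(P)=0$ if $P$ contains a line; otherwise $S(P)(\xi)=\sum_{x\in P\cap\Lambda}e^{\langle\xi,x\rangle}$ and $I(P)(\xi)=\int_P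 e^{\langle\xi,x\rangle}dx$ for all $\xi$ for which the sum (resp. integral) converges absolutely. Rigid complement maps. A rigid complement map $\Psi$ on $V^*$ is a map from a collection $\mathcal L^\Psi$ of linear subspaces of $V^*$ to the set of linear subspaces of $V^*$ such that (a) $V^*=U\oplus\Psi(U)$ for $U\in\mathcal L^\Psi$; (b) if $U_1\subset U_2$ are in $\mathcal L^\Psi$ then $\Psi(U_2)\subset\Psi(U_1)$. Genericity. A quotient $W$ of $V$ is $\Psi$-generic if $W^*\in\mathcal L^\Psi$; a subspace $U\subset V$ is $\Psi$-generic if $V/U$ is; a cone $K$ is $\Psi$-generic if $\mathrm{lin}(F)$ is $\Psi$-generic for every face $F$ of $K$; a polyhedron $P$ is $\Psi$-generic if every $\mathrm{Supp}(P,F)$ is. $\mathcal C^\Psi(V)$ is the set of $\Psi$-generic cones of $V$. If $W$ is a $\Psi$-generic quotient, $\bar\Psi$ denotes the induced complement map on $W^*$: $\bar\Psi(U)=\Psi(U)\cap W^*$ for $U\in\mathcal L^\Psi$, $U\subset W^*$ with $\Psi(U)\cap W^*$ complementary to $U$ in $W^*$; and $\pi_W:V^*\to W^*$ is the projection with kernel $\Psi(W^* )$. Compatible interpolators. A $\Psi$-compatible interpolator is a map $\mu:\mathcal C^\Psi(V)\to\mathcal M(V^* )$ such that (i) $S(P)=\sum_{F\in\mathcal F(P)}\mu(\mathrm{Supp}(P,F))\,I(F)$ for all $\Psi$-generic polyhedra $P$ in $V$; (ii) for every $\Psi$-generic quotient $q:V\to W$, the map $\bar\mu:\mathcal C^{\bar\Psi}(W)\to\mathcal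 M(W^* )$, $\bar\mu(K)=\mu(q^{-1}(K))|_{W^*}$, satisfies the same identity for all $\bar\Psi$-generic polyhedra in $W$; (iii) $\mu(q^{-1}(K))=\bar\mu(K)\circ\pi_W$ for all such $W$ and $K\in\mathcal C^{\bar\Psi}(W)$. There is a unique such map, denoted $\mu^\Psi$, and its values $\mu^\Psi(K)$ are analytic at $\xi=0$. For $f(\xi)=\sum_\alpha a_\alpha\xi^\alpha$ (Taylor series in linear coordinates on $V^*$), $f(\partial_x)=\sum_\alpha a_\alpha\partial_x^\alpha$ in the dual coordinates on $V$, so that formally $f(\partial_x)e^{\langle\xi,x\rangle}=f(\xi)e^{\langle\xi,x\rangle}$. *)

theory Defs
  imports "HOL-Analysis.Analysis"
begin

section \<open>Lattice, quotients and dual spaces\<close>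

text \<open>
  The rational space \<open>V\<close> is \<open>rat ^ 'n\<close>, with lattice the integer vectors; its dual is again
  \<open>rat ^ 'n\<close>, the pairing being \<open>dot\<close>, and the complexified dual is \<open>complex ^ 'n\<close>.

  A quotient \<open>q : V \<rightarrow> W\<close> is given by a square matrix \<open>Q\<close>: \<open>W\<close> is the range of \<open>(*v) Q\<close>, its
  lattice is the image of the integer vectors, and \<open>q\<close> is multiplication by \<open>Q\<close>. Every
  quotient of \<open>V\<close> is isomorphic to one of this form (choose a linear section of the
  projection). \<open>V\<close> itself is the case \<open>Q = mat 1\<close>.
\<close>

definition dot :: "'a::comm_ring_1 ^ 'n \<Rightarrow> 'a ^ 'n \<Rightarrow> 'a" where
  "dot \<xi> x = (\<Sum>i\<in>UNIV. \<xi> $ i * x $ i)"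

definition rat_vec :: "rat ^ 'n \<Rightarrow> 'a::field_char_0 ^ 'n" where
  "rat_vec x = (\<chi> i. of_rat (x $ i))"

definition complex_vec :: "real ^ 'n \<Rightarrow> complex ^ 'n" where
  "complex_vec x = (\<chi> i. of_real (x $ i))"

definition real_mat :: "rat ^ 'n ^ 'n \<Rightarrow> real ^ 'n ^ 'n" where
  "real_mat Q = (\<chi> i j. of_rat (Q $ i $ j))"

definition quotient_space :: "rat ^ 'n ^ 'n \<Rightarrow> (rat ^ 'n) set" where
  "quotient_space Q = range ((*v) Q)"

definition quotient_lattice :: "rat ^ 'n ^ 'n \<Rightarrow> (rat ^ 'n) set" where
  "quotient_lattice Q = (*v) Q ` {z. \<forall>i. z $ i \<in> \<int>}"

text \<open>
  For a subspace \<open>U\<close> of \<open>W\<close>, the dual of \<open>W / U\<close> as a subspace of the dual of \<open>V\<close>: the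
  functionals on \<open>V\<close> that vanish on the preimage of \<open>U\<close>.
\<close>

definition annihilator :: "rat ^ 'n ^ 'n \<Rightarrow> (rat ^ 'n) set \<Rightarrow> (rat ^ 'n) set" where
  "annihilator Q U = {\<eta>. \<forall>v. Q *v v \<in> U \<longrightarrow> dot \<eta> v = 0}"

definition dual_space :: "rat ^ 'n ^ 'n \<Rightarrow> (rat ^ 'n) set" where
  "dual_space Q = annihilator Q {0}"

definition complexify :: "(rat ^ 'n) set \<Rightarrow> (complex ^ 'n) set" where
  "complexify U = vec.span (rat_vec ` U)"

text \<open>
  Pairing of \<open>\<xi>\<close> in the complexified dual of \<open>W\<close>, regarded as a functional on \<open>V\<close> vanishing on
  the kernel of \<open>q\<close>, with a real point \<open>x\<close> of \<open>W\<close>: the value of \<open>\<xi>\<close> at any lift of \<open>x\<close>.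
\<close>

definition pairing :: "rat ^ 'n ^ 'n \<Rightarrow> complex ^ 'n \<Rightarrow> real ^ 'n \<Rightarrow> complex" where
  "pairing Q \<xi> x = (THE c. \<forall>v. real_mat Q *v v = x \<longrightarrow> dot \<xi> (complex_vec v) = c)"

lemma real_mat_1 [simp]: "real_mat (mat 1) = mat 1"
  by (simp add: real_mat_def mat_def vec_eq_iff)

lemma pairing_mat_1: "pairing (mat 1) \<xi> x = dot \<xi> (complex_vec x)"
  by (simp add: pairing_def)

lemma quotient_space_mat_1: "quotient_space (mat 1) = UNIV"
  by (simp add: quotient_space_def)

lemma quotient_lattice_mat_1: "quotient_lattice (mat 1) = {z. \<forall>i. z $ i \<in> \<int>}"
  by (simp add: quotient_lattice_def)

lemma dual_space_mat_1: "dual_space (mat 1) = UNIV"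
  by (simp add: dual_space_def annihilator_def dot_def)


section \<open>Polyhedra\<close>

definition rat_polyhedron :: "rat ^ 'n ^ 'n \<Rightarrow> (rat ^ 'n) set \<Rightarrow> bool" where
  "rat_polyhedron Q P \<longleftrightarrow> P \<noteq> {} \<and>
     (\<exists>H. finite H \<and> P = {x \<in> quotient_space Q. \<forall>(a, b) \<in> H. dot a x \<le> b})"

definition rat_polytope :: "rat ^ 'n ^ 'n \<Rightarrow> (rat ^ 'n) set \<Rightarrow> bool" where
  "rat_polytope Q P \<longleftrightarrow> rat_polyhedron Q P \<and> (\<exists>M. \<forall>x\<in>P. \<forall>i. \<bar>x $ i\<bar> \<le> M)"

definition rat_cone :: "rat ^ 'n ^ 'n \<Rightarrow> (rat ^ 'n) set \<Rightarrow> bool" where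
  "rat_cone Q K \<longleftrightarrow>
     (\<exists>s \<in> quotient_space Q. \<exists>H. finite H \<and>
        K = (+) s ` {x \<in> quotient_space Q. \<forall>a\<in>H. dot a x \<le> 0})"

definition faces :: "(rat ^ 'n) set \<Rightarrow> (rat ^ 'n) set set" where
  "faces P = {F. F \<noteq> {} \<and> (\<exists>a b. (\<forall>x\<in>P. dot a x \<le> b) \<and> F = {x\<in>P. dot a x = b})}"

definition lin :: "(rat ^ 'n) set \<Rightarrow> (rat ^ 'n) set" where
  "lin F = vec.span {x - y | x y. x \<in> F \<and> y \<in> F}"

definition rat_rel_interior :: "(rat ^ 'n) set \<Rightarrow> (rat ^ 'n) set" where
  "rat_rel_interior F =
     {x\<in>F. \<exists>\<epsilon>>0. \<forall>v \<in> lin F. (\<forall>i. \<bar>v $ i\<bar> < \<epsilon>) \<longrightarrow> x + v \<in> F}"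

definition contains_line :: "(rat ^ 'n) set \<Rightarrow> bool" where
  "contains_line P \<longleftrightarrow> (\<exists>x v. v \<noteq> 0 \<and> (\<forall>t. x + t *s v \<in> P))"

text \<open>
  \<open>Tan P F\<close> and \<open>Supp P F\<close> do not depend on the point chosen in the relative interior of
  the face \<open>F\<close>.
\<close>

definition rel_int_point :: "(rat ^ 'n) set \<Rightarrow> rat ^ 'n" where
  "rel_int_point F = (SOME x. x \<in> rat_rel_interior F)"

definition Tan :: "(rat ^ 'n) set \<Rightarrow> (rat ^ 'n) set \<Rightarrow> (rat ^ 'n) set" where
  "Tan P F = {v. \<exists>\<delta>>0. \<forall>\<epsilon>. 0 < \<epsilon> \<and> \<epsilon> < \<delta> \<longrightarrow> rel_int_point F + \<epsilon> *s v \<in> P}"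

definition Supp :: "(rat ^ 'n) set \<Rightarrow> (rat ^ 'n) set \<Rightarrow> (rat ^ 'n) set" where
  "Supp P F = (+) (rel_int_point F) ` Tan P F"


section \<open>Real polyhedra and normalized Lebesgue measure\<close>

text \<open>The real polyhedron of \<open>P\<close>: all real points satisfying the rational inequalities valid on \<open>P\<close>.\<close>

definition real_hull :: "(rat ^ 'n) set \<Rightarrow> (real ^ 'n) set" where
  "real_hull P = {x. \<forall>a b. (\<forall>y\<in>P. dot a y \<le> b) \<longrightarrow> dot (rat_vec a) x \<le> of_rat b}"

definition lattice_basis :: "(rat ^ 'n) set \<Rightarrow> (rat ^ 'n) set \<Rightarrow> bool" where
  "lattice_basis B L \<longleftrightarrow> finite B \<and> \<not> vec.dependent B \<and>
     L = {\<Sum>b\<in>B. of_int (c b) *s b | c. True}"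

text \<open>
  Lebesgue measure on the real affine span of \<open>P\<close>, as a measure on the ambient space: the image
  of the product measure under the affine coordinates given by a basis \<open>B\<close> of the lattice of
  \<open>lin P\<close> and a point \<open>x0\<close> of \<open>P\<close>. It does not depend on \<open>B\<close> and \<open>x0\<close>, and is a unit mass if
  \<open>P\<close> is a point (then \<open>B = {}\<close>).
\<close>

definition aff_measure :: "rat ^ 'n ^ 'n \<Rightarrow> (rat ^ 'n) set \<Rightarrow> (real ^ 'n) measure" where
  "aff_measure Q P =
     (let B = (SOME B. lattice_basis B (quotient_lattice Q \<inter> lin P));
          x0 = (SOME x. x \<in> P)
      in distr (\<Pi>\<^sub>M b\<in>B. lborel) borel
           (\<lambda>t. rat_vec x0 + (\<Sum>b\<in>B. t b *\<^sub>R rat_vec b)))"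

definition vol :: "(rat ^ 'n) set \<Rightarrow> real" where
  "vol F = measure (aff_measure (mat 1) F) (real_hull F)"


section \<open>Meromorphic functions of several variables\<close>

definition monomial :: "('n \<Rightarrow> nat) \<Rightarrow> complex ^ 'n \<Rightarrow> complex" where
  "monomial \<alpha> \<xi> = (\<Prod>i\<in>UNIV. (\<xi> $ i) ^ \<alpha> i)"

text \<open>
  Analyticity at \<open>p\<close> of a function on a linear subspace \<open>A\<close> (that is, in linear coordinates
  of \<open>A\<close>); the ambient coordinates may be used, since a power series in coordinates of \<open>A\<close>
  extends to the ambient space along a linear projection onto \<open>A\<close>.
\<close>

definition analytic_within :: "(complex ^ 'n) set \<Rightarrow> (complex ^ 'n \<Rightarrow> complex) \<Rightarrow> complex ^ 'n \<Rightarrow> bool"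
  where "analytic_within A f p \<longleftrightarrow>
     (\<exists>a. \<exists>r>0. \<forall>\<xi> \<in> A \<inter> ball p r. ((\<lambda>\<alpha>. a \<alpha> * monomial \<alpha> (\<xi> - p)) has_sum f \<xi>) UNIV)"

definition taylor_coeffs :: "(complex ^ 'n \<Rightarrow> complex) \<Rightarrow> ('n \<Rightarrow> nat) \<Rightarrow> complex" where
  "taylor_coeffs f =
     (THE a. \<exists>r>0. \<forall>\<xi> \<in> ball 0 r. ((\<lambda>\<alpha>. a \<alpha> * monomial \<alpha> \<xi>) has_sum f \<xi>) UNIV)"

text \<open>Agreement on a dense relatively open subset: equality as meromorphic functions.\<close>

definition generic_eq ::
    "(complex ^ 'n) set \<Rightarrow> (complex ^ 'n \<Rightarrow> complex) \<Rightarrow> (complex ^ 'n \<Rightarrow> complex) \<Rightarrow> bool" where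
  "generic_eq X f g \<longleftrightarrow>
     (\<exists>T. openin (top_of_set X) T \<and> X \<subseteq> closure T \<and> (\<forall>\<xi>\<in>T. f \<xi> = g \<xi>))"

text \<open>
  The meromorphic functions on a complex subspace \<open>A\<close>, i.e. the local quotients of analytic
  functions, each represented by one function: its value at a point is the value
  of the analytic function it defines near that point, and \<open>0\<close> at points where it is not
  analytic (and outside \<open>A\<close>). In one variable this is the convention of
  \<open>nicely_meromorphic_on\<close>. Sums
  and products in the field of meromorphic functions are the pointwise ones up to
  \<^const>\<open>generic_eq\<close>.
\<close>

definition meromorphic_functions :: "(complex ^ 'n) set \<Rightarrow> (complex ^ 'n \<Rightarrow> complex) set" where
  "meromorphic_functions A = {f.
     (\<forall>\<xi>. \<xi> \<notin> A \<longrightarrow> f \<xi> = 0) \<and>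
     (\<forall>p\<in>A. \<exists>r>0. \<exists>g h.
        (\<forall>\<xi> \<in> A \<inter> ball p r. analytic_within A g \<xi> \<and> analytic_within A h \<xi>) \<and>
        (\<exists>\<xi> \<in> A \<inter> ball p r. h \<xi> \<noteq> 0) \<and>
        (\<forall>\<xi> \<in> A \<inter> ball p r. h \<xi> \<noteq> 0 \<longrightarrow> f \<xi> = g \<xi> / h \<xi>)) \<and>
     (\<forall>p\<in>A. analytic_within A f p \<or>
        f p = 0 \<and> \<not> (\<exists>g. analytic_within A g p \<and> (\<exists>r>0. generic_eq (A \<inter> ball p r) f g)))}"

definition restrict_zero :: "'a set \<Rightarrow> ('a \<Rightarrow> complex) \<Rightarrow> 'a \<Rightarrow> complex" where
  "restrict_zero A f = (\<lambda>\<xi>. if \<xi> \<in> A then f \<xi> else 0)"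


section \<open>Exponential sums and integrals\<close>

definition exp_sum :: "rat ^ 'n ^ 'n \<Rightarrow> (rat ^ 'n) set \<Rightarrow> complex ^ 'n \<Rightarrow> complex" where
  "exp_sum Q P =
     (if contains_line P then (\<lambda>_. 0)
      else (THE f. f \<in> meromorphic_functions (complexify (dual_space Q)) \<and>
        (\<forall>\<xi> \<in> complexify (dual_space Q).
           (\<lambda>x. norm (exp (pairing Q \<xi> (rat_vec x)))) summable_on (P \<inter> quotient_lattice Q) \<longrightarrow>
           f \<xi> = (\<Sum>\<^sub>\<infinity>x \<in> P \<inter> quotient_lattice Q. exp (pairing Q \<xi> (rat_vec x))))))"

definition exp_integral :: "rat ^ 'n ^ 'n \<Rightarrow> (rat ^ 'n) set \<Rightarrow> complex ^ 'n \<Rightarrow> complex" where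
  "exp_integral Q P =
     (if contains_line P then (\<lambda>_. 0)
      else (THE f. f \<in> meromorphic_functions (complexify (dual_space Q)) \<and>
        (\<forall>\<xi> \<in> complexify (dual_space Q).
           set_integrable (aff_measure Q P) (real_hull P) (\<lambda>x. exp (pairing Q \<xi> x)) \<longrightarrow>
           f \<xi> = (LINT x:real_hull P|aff_measure Q P. exp (pairing Q \<xi> x)))))"


section \<open>Rigid complement maps and genericity\<close>

definition direct_sum :: "(rat ^ 'n) set \<Rightarrow> (rat ^ 'n) set \<Rightarrow> (rat ^ 'n) set \<Rightarrow> bool" where
  "direct_sum A U C \<longleftrightarrow> vec.subspace U \<and> vec.subspace C \<and> U \<inter> C = {0} \<and>
     A = {u + c | u c. u \<in> U \<and> c \<in> C}"

text \<open>A complement map is a partial map, the collection it is defined on being its domain.\<close>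

type_synonym 'n complement_map = "(rat ^ 'n) set \<rightharpoonup> (rat ^ 'n) set"

definition rigid_complement_map :: "'n::finite complement_map \<Rightarrow> bool" where
  "rigid_complement_map \<Psi> \<longleftrightarrow>
     (\<forall>U C. \<Psi> U = Some C \<longrightarrow> direct_sum UNIV U C) \<and>
     (\<forall>U1 U2 C1 C2. \<Psi> U1 = Some C1 \<longrightarrow> \<Psi> U2 = Some C2 \<longrightarrow> U1 \<subseteq> U2 \<longrightarrow> C2 \<subseteq> C1)"

text \<open>The complement map induced on the subspace \<open>A\<close> of the dual space.\<close>

definition induced_map :: "'n::finite complement_map \<Rightarrow> (rat ^ 'n) set \<Rightarrow> 'n complement_map" where
  "induced_map \<Psi> A = (\<lambda>U. case \<Psi> U of None \<Rightarrow> None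
     | Some C \<Rightarrow> if U \<subseteq> A \<and> direct_sum A U (C \<inter> A) then Some (C \<inter> A) else None)"

definition generic_quotient :: "'n::finite complement_map \<Rightarrow> rat ^ 'n ^ 'n \<Rightarrow> bool" where
  "generic_quotient \<Psi> Q \<longleftrightarrow> dual_space Q \<in> dom \<Psi>"

definition generic_subspace ::
    "rat ^ 'n ^ 'n \<Rightarrow> 'n::finite complement_map \<Rightarrow> (rat ^ 'n) set \<Rightarrow> bool" where
  "generic_subspace Q \<Psi> U \<longleftrightarrow> annihilator Q U \<in> dom \<Psi>"

definition generic_cones ::
    "rat ^ 'n ^ 'n \<Rightarrow> 'n::finite complement_map \<Rightarrow> (rat ^ 'n) set set" where
  "generic_cones Q \<Psi> = {K. rat_cone Q K \<and> (\<forall>F \<in> faces K. generic_subspace Q \<Psi> (lin F))}"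

definition generic_polyhedron ::
    "rat ^ 'n ^ 'n \<Rightarrow> 'n::finite complement_map \<Rightarrow> (rat ^ 'n) set \<Rightarrow> bool" where
  "generic_polyhedron Q \<Psi> P \<longleftrightarrow>
     rat_polyhedron Q P \<and> (\<forall>F \<in> faces P. Supp P F \<in> generic_cones Q \<Psi>)"


section \<open>Compatible interpolators\<close>

definition projection_along ::
    "(rat ^ 'n) set \<Rightarrow> (rat ^ 'n) set \<Rightarrow> complex ^ 'n \<Rightarrow> complex ^ 'n" where
  "projection_along A C \<xi> = (THE \<eta>. \<eta> \<in> complexify A \<and> \<xi> - \<eta> \<in> complexify C)"

definition interpolator_on ::
    "rat ^ 'n ^ 'n \<Rightarrow> 'n::finite complement_map \<Rightarrow>
     ((rat ^ 'n) set \<Rightarrow> complex ^ 'n \<Rightarrow> complex) \<Rightarrow> bool" where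
  "interpolator_on Q \<Psi> \<mu> \<longleftrightarrow>
     (\<forall>K \<in> generic_cones Q \<Psi>. \<mu> K \<in> meromorphic_functions (complexify (dual_space Q))) \<and>
     (\<forall>P. generic_polyhedron Q \<Psi> P \<longrightarrow>
        generic_eq (complexify (dual_space Q)) (exp_sum Q P)
          (\<lambda>\<xi>. \<Sum>F\<in>faces P. \<mu> (Supp P F) \<xi> * exp_integral Q F \<xi>))"

definition quotient_interpolator ::
    "rat ^ 'n ^ 'n \<Rightarrow> ((rat ^ 'n) set \<Rightarrow> complex ^ 'n \<Rightarrow> complex) \<Rightarrow>
     (rat ^ 'n) set \<Rightarrow> complex ^ 'n \<Rightarrow> complex" where
  "quotient_interpolator Q \<mu> K =
     restrict_zero (complexify (dual_space Q)) (\<mu> ((*v) Q -` K))"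

definition compatible_interpolator ::
    "'n::finite complement_map \<Rightarrow> ((rat ^ 'n) set \<Rightarrow> complex ^ 'n \<Rightarrow> complex) \<Rightarrow> bool" where
  "compatible_interpolator \<Psi> \<mu> \<longleftrightarrow>
     interpolator_on (mat 1) \<Psi> \<mu> \<and>
     (\<forall>Q. generic_quotient \<Psi> Q \<longrightarrow>
        interpolator_on Q (induced_map \<Psi> (dual_space Q)) (quotient_interpolator Q \<mu>) \<and>
        (\<forall>K \<in> generic_cones Q (induced_map \<Psi> (dual_space Q)). \<forall>\<xi>.
           \<mu> ((*v) Q -` K) \<xi> =
           quotient_interpolator Q \<mu> K
             (projection_along (dual_space Q) (the (\<Psi> (dual_space Q))) \<xi>)))"


section \<open>Differential operators of infinite order\<close>

definition partial_deriv :: "'n::finite \<Rightarrow> (real ^ 'n \<Rightarrow> complex) \<Rightarrow> real ^ 'n \<Rightarrow> complex" where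
  "partial_deriv i h x = vector_derivative (\<lambda>t. h (x + t *\<^sub>R axis i 1)) (at 0)"

text \<open>The order of differentiation chosen here is irrelevant for smooth functions.\<close>

definition mixed_deriv :: "('n::finite \<Rightarrow> nat) \<Rightarrow> (real ^ 'n \<Rightarrow> complex) \<Rightarrow> real ^ 'n \<Rightarrow> complex" where
  "mixed_deriv \<alpha> h =
     fold (\<lambda>i. partial_deriv i ^^ \<alpha> i) (SOME is. distinct is \<and> set is = UNIV) h"

text \<open>For a polynomial function \<open>h\<close>, all but finitely many terms of the sum vanish.\<close>

definition diff_op ::
    "(complex ^ 'n::finite \<Rightarrow> complex) \<Rightarrow> (real ^ 'n \<Rightarrow> complex) \<Rightarrow> real ^ 'n \<Rightarrow> complex" where
  "diff_op f h x = (\<Sum>\<^sub>\<infinity>\<alpha>. taylor_coeffs f \<alpha> * mixed_deriv \<alpha> h x)"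

end

theory Submission
  imports Defs
begin

text \<open>
  For a polytope all exponential sums and integrals are entire functions of \<open>\<xi>\<close>. Near \<open>\<xi> = 0\<close>
  the interpolation identity is therefore an identity of convergent power series,
  \<open>\<Sum>\<^sub>x e\<^bsup>\<langle>\<xi>, x\<rangle>\<^esup> = \<Sum>\<^sub>F \<mu>\<^sub>F(\<xi>) \<integral>\<^sub>F e\<^bsup>\<langle>\<xi>, x\<rangle>\<^esup> dx\<close>. Its coefficient at \<open>\<xi>\<^sup>\<beta>\<close>, multiplied by \<open>\<beta>!\<close>, is the
  claim for \<open>h = x\<^sup>\<beta>\<close>, because \<open>\<partial>\<^sup>\<alpha> (x\<^sup>\<beta> / \<beta>!) = x\<^bsup>\<beta> - \<alpha>\<^esup> / (\<beta> - \<alpha>)!\<close>; the general case is linearity in \<open>h\<close>.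
\<close>

section \<open>Products of infinite sums\<close>

text \<open>Comparing coefficients is not immediate. The interpolation identity is only a
  \<open>generic_eq\<close>, agreement on a dense open set, and \<open>analytic_within\<close>
  speaks of unordered sums over multi-indices. The difference of the two sides must first be shown
  continuous near \<open>0\<close>, and an identity theorem for such series is needed. Unordered
  summability of complex families is absolute, so convergence at one corner of a polydisc dominates
  a power series on the whole polydisc. The second obstacle is that \<open>exp_sum\<close> and
  \<open>exp_integral\<close> are definite descriptions over \<open>meromorphic_functions\<close>.
  For bounded sets absolute convergence at every \<open>\<xi>\<close> forces the values. That the
  explicit formula is a legitimate candidate is shown by expanding it around every point
  \<open>p\<close>, not only around \<open>0\<close>. For integrals this requires the real hull of a
  face to have finite mass, hence a genuine lattice basis behind the \<open>SOME\<close> in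
  \<open>aff_measure\<close>.\<close>

lemma has_sum_imp_abs_summable_complex:
  fixes f :: "'a \<Rightarrow> complex"
  assumes "(f has_sum s) A"
  shows "(\<lambda>x. norm (f x)) summable_on A"
  using assms summable_on_iff_abs_summable_on_complex summable_on_def by blast

text \<open>Absolute convergence of both factors makes the product family summable over the product
  set; its value is then found by summing over \<open>B\<close> first.\<close>

lemma has_sum_Times_complex:
  fixes f :: "'a \<Rightarrow> complex" and g :: "'b \<Rightarrow> complex"
  assumes f: "(f has_sum a) A" and g: "(g has_sum b) B"
  shows "((\<lambda>(x, y). f x * g y) has_sum a * b) (A \<times> B)"
proof -
  have "(\<lambda>x. norm (f x)) summable_on A" "(\<lambda>x. norm (g x)) summable_on B"
    by (rule has_sum_imp_abs_summable_complex[OF f], rule has_sum_imp_abs_summable_complex[OF g])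
  then have "(\<lambda>z. norm (case z of (x, y) \<Rightarrow> f x * g y)) summable_on (A \<times> B)"
    unfolding Infinite_Sum.abs_summable_on_Sigma_iff
    by (auto simp: norm_mult abs_mult infsum_cmult_right' intro!: summable_on_cmult_right summable_on_cmult_left)
  then have "(\<lambda>(x, y). f x * g y) summable_on (A \<times> B)"
    by (rule abs_summable_summable)
  then obtain s where s: "((\<lambda>(x, y). f x * g y) has_sum s) (A \<times> B)"
    by (auto simp: summable_on_def)
  have "((\<lambda>x. f x * b) has_sum s) A"
    by (rule has_sum_SigmaD[OF s]) (auto intro!: has_sum_cmult_right g)
  moreover have "((\<lambda>x. f x * b) has_sum (a * b)) A"
    by (intro has_sum_cmult_left f)
  ultimately show ?thesis
    using s has_sum_unique by blast
qed

lemma has_sum_prod_UNIV: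
  fixes f :: "'n::finite \<Rightarrow> nat \<Rightarrow> complex"
  assumes "\<And>i. (f i has_sum s i) UNIV"
  shows "((\<lambda>\<alpha>. \<Prod>i\<in>UNIV. f i (\<alpha> i)) has_sum (\<Prod>i\<in>UNIV. s i)) UNIV"
proof -
  have abs: "(\<lambda>k. norm (f i k)) summable_on UNIV" for i
    using assms by (rule has_sum_imp_abs_summable_complex)
  have "Infinite_Set_Sum.abs_summable_on (\<lambda>\<alpha>. \<Prod>i\<in>UNIV. f i (\<alpha> i)) (PiE UNIV (\<lambda>_. UNIV))"
    by (intro abs_summable_on_prod_PiE) (use abs abs_summable_equivalent in auto)
  then have "(\<lambda>\<alpha>. norm (\<Prod>i\<in>UNIV. f i (\<alpha> i))) summable_on UNIV"
    by (simp add: abs_summable_equivalent)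
  then have "(\<lambda>\<alpha>. \<Prod>i\<in>UNIV. f i (\<alpha> i)) summable_on UNIV"
    by (rule abs_summable_summable)
  moreover have "(\<Sum>\<^sub>\<infinity>\<alpha>. \<Prod>i\<in>UNIV. f i (\<alpha> i)) = (\<Prod>i\<in>UNIV. \<Sum>\<^sub>\<infinity>k. f i k)"
    using infsum_prod_PiE_abs[of UNIV f "\<lambda>_. UNIV"] abs by simp
  moreover have "(\<Sum>\<^sub>\<infinity>k. f i k) = s i" for i
    using assms infsumI by blast
  ultimately show ?thesis
    by (simp add: has_sum_iff)
qed

section \<open>Power series in several variables\<close>

lemma monomial_add: "monomial (\<lambda>i. \<alpha> i + \<beta> i) \<xi> = monomial \<alpha> \<xi> * monomial \<beta> \<xi>"
  by (simp add: monomial_def power_add prod.distrib)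

lemma monomial_zero_index [simp]: "monomial (\<lambda>_. 0) \<xi> = 1"
  by (simp add: monomial_def)

lemma monomial_at_zero: "monomial \<alpha> 0 = (if \<alpha> = (\<lambda>_. 0) then 1 else 0)"
  by (auto simp: monomial_def fun_eq_iff)

lemma continuous_on_monomial [continuous_intros]:
  "continuous_on S f \<Longrightarrow> continuous_on S (\<lambda>x. monomial \<alpha> (f x))"
  unfolding monomial_def by (intro continuous_intros)

text \<open>The point on the right is the corner of a polydisc: summability there provides a
  majorant on the entire polydisc.\<close>

lemma norm_monomial_le:
  assumes "\<And>i. norm (\<xi> $ i) \<le> \<rho>"
  shows "norm (monomial \<alpha> \<xi>) \<le> norm (monomial \<alpha> (\<chi> i. of_real \<rho>))"
proof -
  have "norm (\<xi> $ i) \<le> \<bar>\<rho>\<bar>" for i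
    using assms[of i] by linarith
  then show ?thesis
    unfolding monomial_def prod_norm[symmetric] by (intro prod_mono) (auto simp: norm_power intro!: power_mono)
qed

text \<open>The body is the condition under the description in \<open>taylor_coeffs\<close>, so that
  \<open>taylor_coeffs f\<close> is \<open>THE a. power_series_near_0 f a\<close>.\<close>

definition power_series_near_0 ::
    "(complex ^ 'n::finite \<Rightarrow> complex) \<Rightarrow> (('n \<Rightarrow> nat) \<Rightarrow> complex) \<Rightarrow> bool" where
  "power_series_near_0 f a \<longleftrightarrow>
     (\<exists>r>0. \<forall>\<xi>\<in>ball 0 r. ((\<lambda>\<alpha>. a \<alpha> * monomial \<alpha> \<xi>) has_sum f \<xi>) UNIV)"

lemma power_series_near_0_add:
  assumes "power_series_near_0 f a" "power_series_near_0 g b"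
  shows "power_series_near_0 (\<lambda>\<xi>. f \<xi> + g \<xi>) (\<lambda>\<alpha>. a \<alpha> + b \<alpha>)"
proof -
  obtain r s where rs: "r > 0" "s > 0"
    "\<And>\<xi>. \<xi> \<in> ball 0 r \<Longrightarrow> ((\<lambda>\<alpha>. a \<alpha> * monomial \<alpha> \<xi>) has_sum f \<xi>) UNIV"
    "\<And>\<xi>. \<xi> \<in> ball 0 s \<Longrightarrow> ((\<lambda>\<alpha>. b \<alpha> * monomial \<alpha> \<xi>) has_sum g \<xi>) UNIV"
    using assms unfolding power_series_near_0_def by blast
  show ?thesis
    unfolding power_series_near_0_def
    by (intro exI[of _ "min r s"]) (use rs in \<open>auto simp: distrib_right intro!: has_sum_add\<close>)
qed

lemma power_series_near_0_cmult:
  assumes "power_series_near_0 f a"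
  shows "power_series_near_0 (\<lambda>\<xi>. c * f \<xi>) (\<lambda>\<alpha>. c * a \<alpha>)"
  using assms unfolding power_series_near_0_def
  by (force simp: mult.assoc intro!: has_sum_cmult_right)

text \<open>
  For infinite \<open>J\<close> both sums are \<open>0\<close>; this is how the set of faces, whose finiteness is
  not established, is covered.
\<close>

lemma power_series_near_0_sum:
  assumes "\<And>j. j \<in> J \<Longrightarrow> power_series_near_0 (f j) (a j)"
  shows "power_series_near_0 (\<lambda>\<xi>. \<Sum>j\<in>J. f j \<xi>) (\<lambda>\<alpha>. \<Sum>j\<in>J. a j \<alpha>)"
proof -
  have zero: "power_series_near_0 (\<lambda>_. 0) (\<lambda>_. 0)"
    unfolding power_series_near_0_def by (auto intro!: exI[of _ 1])
  show ?thesis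
    using assms
    by (induction J rule: infinite_finite_induct)
       (auto simp: zero intro!: power_series_near_0_add)
qed

text \<open>The order on multi-indices is pointwise, so the truncated subtraction is exact in every
  summand.\<close>

definition cauchy_product ::
    "(('n \<Rightarrow> nat) \<Rightarrow> complex) \<Rightarrow> (('n \<Rightarrow> nat) \<Rightarrow> complex) \<Rightarrow> ('n \<Rightarrow> nat) \<Rightarrow> complex" where
  "cauchy_product a b = (\<lambda>\<beta>. \<Sum>\<alpha> | \<alpha> \<le> \<beta>. a \<alpha> * b (\<lambda>i. \<beta> i - \<alpha> i))"

lemma finite_multi_index_atMost: "finite {\<alpha>. \<alpha> \<le> (\<beta> :: 'n::finite \<Rightarrow> nat)}"
proof -
  have "{\<alpha>. \<alpha> \<le> \<beta>} = PiE UNIV (\<lambda>i. {..\<beta> i})"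
    by (auto simp: le_fun_def)
  then show ?thesis
    by (simp add: finite_PiE)
qed

lemma power_series_near_0_mult:
  assumes "power_series_near_0 f a" "power_series_near_0 g b"
  shows "power_series_near_0 (\<lambda>\<xi>. f \<xi> * g \<xi>) (cauchy_product a b)"
proof -
  obtain r s where rs: "r > 0" "s > 0"
    "\<And>\<xi>. \<xi> \<in> ball 0 r \<Longrightarrow> ((\<lambda>\<alpha>. a \<alpha> * monomial \<alpha> \<xi>) has_sum f \<xi>) UNIV"
    "\<And>\<xi>. \<xi> \<in> ball 0 s \<Longrightarrow> ((\<lambda>\<alpha>. b \<alpha> * monomial \<alpha> \<xi>) has_sum g \<xi>) UNIV"
    using assms unfolding power_series_near_0_def by blast
  have "((\<lambda>\<beta>. cauchy_product a b \<beta> * monomial \<beta> \<xi>) has_sum f \<xi> * g \<xi>) UNIV"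
    if "\<xi> \<in> ball 0 (min r s)" for \<xi>
  proof -
    have "((\<lambda>(\<alpha>, \<gamma>). (a \<alpha> * monomial \<alpha> \<xi>) * (b \<gamma> * monomial \<gamma> \<xi>)) has_sum f \<xi> * g \<xi>) (UNIV \<times> UNIV)"
      by (intro has_sum_Times_complex rs) (use that in auto)
    \<comment> \<open>Group the pairs \<open>(\<alpha>, \<gamma>)\<close> by their sum
      \<open>\<beta>\<close>. Each group is finite, and its total is the coefficient of the product
      at \<open>\<beta>\<close>.\<close>
    also have "?this \<longleftrightarrow> ((\<lambda>(\<beta>, \<alpha>). a \<alpha> * b (\<lambda>i. \<beta> i - \<alpha> i) * monomial \<beta> \<xi>) has_sum f \<xi> * g \<xi>)
        (SIGMA \<beta>:UNIV. {\<alpha>. \<alpha> \<le> \<beta>})"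
      by (rule has_sum_reindex_bij_witness[of _ "\<lambda>(\<beta>, \<alpha>). (\<alpha>, \<lambda>i. \<beta> i - \<alpha> i)"
            "\<lambda>(\<alpha>, \<gamma>). (\<lambda>i. \<alpha> i + \<gamma> i, \<alpha>)"])
         (auto simp: le_fun_def monomial_add mult_ac)
    finally show ?thesis
      unfolding cauchy_product_def
      by (rule has_sum_SigmaD)
         (auto simp: finite_multi_index_atMost sum_distrib_right intro!: has_sum_finiteI)
  qed
  then show ?thesis
    unfolding power_series_near_0_def using rs(1,2) by (intro exI[of _ "min r s"]) auto
qed

text \<open>The error is the sum over \<open>A - G\<close>, dominated by the tail of
  \<open>b\<close>. The bound depends only on \<open>b\<close> and \<open>G\<close>, which gives
  uniformity in parameters, as in the Weierstrass M-test; with \<open>G = {}\<close> it bounds the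
  whole sum.\<close>

lemma has_sum_comparison_norm:
  fixes f :: "'a \<Rightarrow> complex"
  assumes f: "(f has_sum s) A" and b: "b summable_on A" and "\<And>x. x \<in> A \<Longrightarrow> norm (f x) \<le> b x"
    and G: "finite G" "G \<subseteq> A"
  shows "norm (s - sum f G) \<le> infsum b A - sum b G"
proof -
  have s: "(f has_sum s - sum f G) (A - G)"
    by (intro has_sum_Diff f G has_sum_finite)
  have b': "(b has_sum (infsum b A - sum b G)) (A - G)"
    by (intro has_sum_Diff has_sum_infsum b G has_sum_finite)
  have "(\<lambda>x. norm (f x)) summable_on A"
    using f by (rule has_sum_imp_abs_summable_complex)
  then have "(\<lambda>x. norm (f x)) summable_on (A - G)"
    by (rule summable_on_subset_banach) auto
  then obtain t where t: "((\<lambda>x. norm (f x)) has_sum t) (A - G)"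
    by (auto simp: summable_on_def)
  have "norm (s - sum f G) \<le> t"
    by (rule norm_has_sum_bound[OF t s])
  also have "t \<le> infsum b A - sum b G"
    by (rule has_sum_mono[OF t b']) (use assms(3) in auto)
  finally show ?thesis .
qed

lemma continuous_on_has_sum:
  fixes f :: "'a \<Rightarrow> 'b::topological_space \<Rightarrow> complex"
  assumes "\<And>\<alpha>. continuous_on S (f \<alpha>)"
    and "\<And>x. x \<in> S \<Longrightarrow> ((\<lambda>\<alpha>. f \<alpha> x) has_sum g x) UNIV"
    and "\<And>\<alpha> x. x \<in> S \<Longrightarrow> norm (f \<alpha> x) \<le> b \<alpha>" and b: "b summable_on UNIV"
  shows "continuous_on S g"
proof (rule uniform_limit_theorem)
  have tail: "norm (g x - sum (\<lambda>\<alpha>. f \<alpha> x) G) \<le> infsum b UNIV - sum b G" if "x \<in> S" "finite G" for x G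
    by (rule has_sum_comparison_norm) (use assms that in auto)
  have "((\<lambda>G. infsum b UNIV - sum b G) \<longlongrightarrow> infsum b UNIV - infsum b UNIV) (finite_subsets_at_top UNIV)"
    using has_sum_infsum[OF b] unfolding has_sum_def by (intro tendsto_intros)
  then have lim: "((\<lambda>G. infsum b UNIV - sum b G) \<longlongrightarrow> 0) (finite_subsets_at_top UNIV)"
    by simp
  show "uniform_limit S (\<lambda>G x. \<Sum>\<alpha>\<in>G. f \<alpha> x) g (finite_subsets_at_top UNIV)"
  proof (rule uniform_limitI)
    fix e :: real assume "e > 0"
    then have "\<forall>\<^sub>F G in finite_subsets_at_top UNIV. infsum b UNIV - sum b G < e"
      using lim by (simp add: order_tendstoD)
    moreover have "\<forall>\<^sub>F G in finite_subsets_at_top (UNIV :: 'a set). finite G"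
      by (simp add: eventually_finite_subsets_at_top_weakI)
    ultimately show "\<forall>\<^sub>F G in finite_subsets_at_top UNIV. \<forall>x\<in>S. dist (\<Sum>\<alpha>\<in>G. f \<alpha> x) (g x) < e"
    proof eventually_elim
      case (elim G)
      then show ?case
        using tail[of _ G] by (force simp: dist_norm norm_minus_commute)
    qed
  qed
qed (auto intro!: always_eventually continuous_intros assms)

lemma norm_vec_le_card:
  fixes \<xi> :: "complex ^ 'n::finite"
  assumes "\<And>i. norm (\<xi> $ i) \<le> \<rho>"
  shows "norm \<xi> \<le> real CARD('n) * \<rho>"
proof -
  have "norm \<xi> \<le> (\<Sum>i\<in>UNIV. norm (\<xi> $ i))"
    unfolding norm_vec_def by (rule L2_set_le_sum) simp
  also have "\<dots> \<le> real CARD('n) * \<rho>"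
    using sum_bounded_above[of "UNIV :: 'n set" "\<lambda>i. norm (\<xi> $ i)" \<rho>] assms by simp
  finally show ?thesis .
qed

lemma power_series_near_0_continuous:
  assumes "power_series_near_0 f a"
  shows "\<exists>r>0. continuous_on (ball 0 r) f"
proof -
  obtain r where r: "r > 0"
    "\<And>\<xi>. \<xi> \<in> ball 0 r \<Longrightarrow> ((\<lambda>\<alpha>. a \<alpha> * monomial \<alpha> \<xi>) has_sum f \<xi>) UNIV"
    using assms unfolding power_series_near_0_def by blast
  \<comment> \<open>The corner \<open>c\<close> of the polydisc of radius \<open>\<rho>\<close> has
    norm at most \<open>r / 2\<close>, so the series converges absolutely there, and its terms at
    \<open>c\<close> are the majorants.\<close>
  define \<rho> where "\<rho> = r / (2 * real CARD('a))"
  define c :: "complex ^ 'a" where "c = (\<chi> i. of_real \<rho>)"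
  have \<rho>: "\<rho> > 0"
    using r(1) by (simp add: \<rho>_def)
  have "norm c \<le> real CARD('a) * \<rho>"
    by (intro norm_vec_le_card) (use \<rho> in \<open>simp add: c_def\<close>)
  also have "\<dots> < r"
    using r(1) by (simp add: \<rho>_def)
  finally have c: "c \<in> ball 0 r"
    by simp
  have \<rho>r: "\<rho> \<le> r"
  proof -
    have "real CARD('a) \<ge> 1"
      using zero_less_card_finite[where 'a = 'a] by linarith
    then have "r / (2 * real CARD('a)) \<le> r / 1"
      using r(1) by (intro divide_left_mono) linarith+
    then show ?thesis
      by (simp add: \<rho>_def)
  qed
  have sm: "(\<lambda>\<alpha>. norm (a \<alpha> * monomial \<alpha> c)) summable_on UNIV"
    using r(2)[OF c] by (rule has_sum_imp_abs_summable_complex)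
  have "continuous_on (ball 0 \<rho>) f"
  proof (rule continuous_on_has_sum[OF _ _ _ sm])
    fix \<alpha> and \<xi> :: "complex ^ 'a" assume "\<xi> \<in> ball 0 \<rho>"
    then have "norm (\<xi> $ i) \<le> \<rho>" for i
      using Finite_Cartesian_Product.norm_nth_le[of \<xi> i] by simp
    then show "norm (a \<alpha> * monomial \<alpha> \<xi>) \<le> norm (a \<alpha> * monomial \<alpha> c)"
      unfolding norm_mult c_def by (intro mult_left_mono norm_monomial_le) auto
  qed (use r(2) \<rho>r in \<open>auto intro!: continuous_intros\<close>)
  then show ?thesis
    using \<rho> by blast
qed

text \<open>
  Substituting \<open>\<xi>\<^sub>i = p\<^sub>i powr (- s)\<close> for distinct primes \<open>p\<^sub>i\<close> turns the power series into a
  Dirichlet series, whose terms have pairwise different decay as \<open>s\<close> grows; so the first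
  nonzero coefficient would dominate all the others.
\<close>

lemma power_series_near_0_zero_unique:
  fixes a :: "('n::finite \<Rightarrow> nat) \<Rightarrow> complex"
  assumes f: "power_series_near_0 f a" and "r > 0" and "\<And>\<xi>. \<xi> \<in> ball 0 r \<Longrightarrow> f \<xi> = 0"
  shows "a \<alpha> = 0"
proof (rule ccontr)
  assume "a \<alpha> \<noteq> 0"
  obtain r' where r': "r' > 0"
    "\<And>\<xi>. \<xi> \<in> ball 0 r' \<Longrightarrow> ((\<lambda>\<alpha>. a \<alpha> * monomial \<alpha> \<xi>) has_sum 0) UNIV"
  proof -
    obtain r' where "r' > 0"
      "\<And>\<xi>. \<xi> \<in> ball 0 r' \<Longrightarrow> ((\<lambda>\<alpha>. a \<alpha> * monomial \<alpha> \<xi>) has_sum f \<xi>) UNIV"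
      using f unfolding power_series_near_0_def by blast
    then show thesis
      using assms(2,3) by (intro that[of "min r r'"]) force+
  qed
  obtain S :: "nat set" where S: "S \<subseteq> {p. prime p}" "card S = CARD('n)" "finite S"
    using infinite_arbitrarily_large[OF primes_infinite] by blast
  obtain p where p: "bij_betw p (UNIV :: 'n set) S"
    using S finite_same_card_bij[of "UNIV :: 'n set" S] by auto
  have prime: "prime (p i)" for i
    using p S(1) bij_betwE by blast
  \<comment> \<open>Unique factorization makes \<open>N\<close> injective on multi-indices, and at
    the points \<open>x s\<close> below the monomial of index \<open>\<beta>\<close> takes the value
    \<open>(1 / N \<beta>) ^ s\<close>.\<close>
  define N where "N \<beta> = (\<Prod>i\<in>UNIV. p i ^ \<beta> i)" for \<beta>
  have inj: "\<beta> = \<gamma>" if "N \<beta> = N \<gamma>" for \<beta> \<gamma>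
  proof
    fix i
    have "multiplicity (p i) (N \<delta>) = \<delta> i" for \<delta>
    proof -
      have inv: "inv_into UNIV p (p j) = j" for j
        using p by (simp add: bij_betw_def inv_into_f_f)
      have "N \<delta> = (\<Prod>q\<in>S. q ^ \<delta> (inv_into UNIV p q))"
        unfolding N_def
        using prod.reindex_bij_betw[OF p, of "\<lambda>q. q ^ \<delta> (inv_into UNIV p q)"] by (simp add: inv)
      moreover have "p i \<in> S"
        using p bij_betwE by blast
      ultimately show ?thesis
        using multiplicity_prod_prime_powers[of S "p i" "\<lambda>q. \<delta> (inv_into UNIV p q)"] S prime
        by (auto simp: inv)
    qed
    then show "\<beta> i = \<gamma> i"
      using that by metis
  qed
  have Npos: "N \<beta> > 0" for \<beta>
    unfolding N_def using prime prime_gt_0_nat by (simp add: prod_pos)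
  define x :: "nat \<Rightarrow> complex ^ 'n" where "x s = (\<chi> i. (1 / of_nat (p i)) ^ s)" for s
  have mon: "monomial \<beta> (x s) = (1 / of_nat (N \<beta>)) ^ s" for \<beta> s
  proof -
    have "monomial \<beta> (x s) = (\<Prod>i\<in>UNIV. ((1 / of_nat (p i)) ^ \<beta> i) ^ s)"
      unfolding monomial_def x_def by (simp add: mult.commute flip: power_mult)
    also have "\<dots> = (1 / of_nat (N \<beta>)) ^ s"
      unfolding N_def by (simp add: prod_dividef power_one_over flip: prod_power_distrib)
    finally show ?thesis .
  qed
  \<comment> \<open>Least \<open>N\<close> means slowest decay: among the nonzero terms this one
    dominates for large \<open>s\<close>.\<close>
  obtain \<alpha>0 where \<alpha>0: "a \<alpha>0 \<noteq> 0" and least: "\<And>\<beta>. a \<beta> \<noteq> 0 \<Longrightarrow> N \<alpha>0 \<le> N \<beta>"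
    using ex_has_least_nat[of "\<lambda>\<beta>. a \<beta> \<noteq> 0" \<alpha> N] \<open>a \<alpha> \<noteq> 0\<close> by blast
  \<comment> \<open>Primes are at least \<open>2\<close>, so each coordinate of \<open>x s\<close>
    is at most \<open>(1 / 2) ^ s\<close>; this brings \<open>x s\<close> into the ball of
    convergence.\<close>
  have "(\<lambda>s. real CARD('n) * (1 / 2) ^ s) \<longlonglongrightarrow> real CARD('n) * 0"
    by (intro tendsto_intros LIMSEQ_realpow_zero) auto
  then have "\<forall>\<^sub>F s in sequentially. real CARD('n) * (1 / 2) ^ s < r'"
    by (rule order_tendstoD) (use r'(1) in simp)
  then obtain s0 where s0: "\<And>s. s \<ge> s0 \<Longrightarrow> real CARD('n) * (1 / 2) ^ s < r'"
    by (auto simp: eventually_sequentially)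
  have ball: "x s \<in> ball 0 r'" if "s \<ge> s0" for s
  proof -
    have "norm (x s $ i) \<le> (1 / 2) ^ s" for i
      using prime[of i, THEN prime_ge_2_nat]
      by (auto simp: x_def norm_power norm_divide field_simps intro!: power_mono)
    then have "norm (x s) \<le> real CARD('n) * (1 / 2) ^ s"
      by (rule norm_vec_le_card)
    with s0[OF that] show ?thesis
      by simp
  qed
  define b where "b \<beta> = norm (a \<beta> * monomial \<beta> (x s0))" for \<beta>
  define B where "B = UNIV - {\<alpha>0}"
  have "b summable_on UNIV"
    unfolding b_def by (rule has_sum_imp_abs_summable_complex[OF r'(2)[OF ball]]) simp
  then have b: "b summable_on B"
    using summable_on_subset_banach by blast
  \<comment> \<open>The remaining nonzero terms have \<open>N \<beta> \<ge> N \<alpha>0 + 1\<close>,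
    so \<open>q < 1\<close> bounds their decay per step relative to the leading term.\<close>
  define q where "q = real (N \<alpha>0) / (real (N \<alpha>0) + 1)"
  have "b \<alpha>0 \<le> q ^ t * infsum b B" for t
  proof -
    \<comment> \<open>Passing from \<open>s0\<close> to \<open>s0 + t\<close> multiplies the norm of
      the term at \<open>\<beta>\<close> by \<open>(1 / N \<beta>) ^ t\<close>, so summability at
      the single point \<open>x s0\<close> controls all \<open>t\<close>.\<close>
    define y where "y = x (s0 + t)"
    have "((\<lambda>\<beta>. a \<beta> * monomial \<beta> y) has_sum 0 - (\<Sum>\<beta>\<in>{\<alpha>0}. a \<beta> * monomial \<beta> y)) B"
      unfolding B_def y_def by (intro has_sum_Diff r' ball has_sum_finite) auto
    then have hs: "((\<lambda>\<beta>. a \<beta> * monomial \<beta> y) has_sum - (a \<alpha>0 * monomial \<alpha>0 y)) B"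
      by simp
    have bound: "norm (a \<beta> * monomial \<beta> y) \<le> (1 / (real (N \<alpha>0) + 1)) ^ t * b \<beta>" if "\<beta> \<in> B" for \<beta>
    proof (cases "a \<beta> = 0")
      case False
      have "N \<beta> \<noteq> N \<alpha>0"
        using that inj unfolding B_def by blast
      with least[OF False] have "real (N \<alpha>0) + 1 \<le> real (N \<beta>)"
        by linarith
      then have "(1 / real (N \<beta>)) ^ t \<le> (1 / (real (N \<alpha>0) + 1)) ^ t"
        by (intro power_mono) (auto simp: field_simps)
      moreover have "norm (a \<beta> * monomial \<beta> y) = (1 / real (N \<beta>)) ^ t * b \<beta>"
        unfolding b_def y_def mon by (simp add: norm_mult norm_power norm_divide power_add)
      ultimately show ?thesis
        by (simp add: b_def mult_right_mono)
    qed (simp add: b_def)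
    have "norm (- (a \<alpha>0 * monomial \<alpha>0 y) - (\<Sum>\<beta>\<in>{}. a \<beta> * monomial \<beta> y)) \<le>
        infsum (\<lambda>\<beta>. (1 / (real (N \<alpha>0) + 1)) ^ t * b \<beta>) B - (\<Sum>\<beta>\<in>{}. (1 / (real (N \<alpha>0) + 1)) ^ t * b \<beta>)"
      by (rule has_sum_comparison_norm[OF hs]) (use b bound in \<open>auto intro!: summable_on_cmult_right\<close>)
    then have "norm (a \<alpha>0 * monomial \<alpha>0 y) \<le> (1 / (real (N \<alpha>0) + 1)) ^ t * infsum b B"
      by (simp add: infsum_cmult_right')
    moreover have "norm (a \<alpha>0 * monomial \<alpha>0 y) = (1 / real (N \<alpha>0)) ^ t * b \<alpha>0"
      unfolding b_def y_def mon by (simp add: norm_mult norm_power norm_divide power_add)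
    ultimately show ?thesis
      using Npos[of \<alpha>0] by (simp add: q_def field_simps)
  qed
  moreover have "(\<lambda>t. q ^ t * infsum b B) \<longlonglongrightarrow> 0 * infsum b B"
    by (intro tendsto_intros LIMSEQ_realpow_zero) (auto simp: q_def)
  ultimately have "b \<alpha>0 \<le> 0"
    by (intro LIMSEQ_le_const) auto
  then show False
    using \<alpha>0 Npos[of \<alpha>0] by (simp add: b_def mon)
qed

text \<open>Near \<open>0\<close> the difference is continuous, so the set where it is nonzero is
  open there; being disjoint from a dense set, it is empty. Hence the difference vanishes on a ball
  and so do its coefficients.\<close>

lemma power_series_near_0_unique:
  assumes f: "power_series_near_0 f a" and g: "power_series_near_0 g b" and eq: "generic_eq UNIV f g"
  shows "a = b"
proof
  fix \<alpha>
  have diff: "power_series_near_0 (\<lambda>\<xi>. f \<xi> + (-1) * g \<xi>) (\<lambda>\<alpha>. a \<alpha> + (-1) * b \<alpha>)"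
    by (intro power_series_near_0_add power_series_near_0_cmult f g)
  then obtain r where r: "r > 0" "continuous_on (ball 0 r) (\<lambda>\<xi>. f \<xi> + (-1) * g \<xi>)"
    using power_series_near_0_continuous by blast
  obtain T where T: "open T" "closure T = UNIV" "\<And>\<xi>. \<xi> \<in> T \<Longrightarrow> f \<xi> = g \<xi>"
    using eq unfolding generic_eq_def by auto
  define D where "D = ball 0 r \<inter> (\<lambda>\<xi>. f \<xi> + (-1) * g \<xi>) -` (- {0})"
  have "open D"
    unfolding D_def by (rule continuous_open_preimage) (use r(2) in auto)
  moreover have "D \<inter> T = {}"
    using T(3) by (auto simp: D_def)
  ultimately have "D = {}"
    using open_Int_closure_eq_empty[of D T] T(2) by auto
  then have "f \<xi> + (-1) * g \<xi> = 0" if "\<xi> \<in> ball 0 r" for \<xi>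
    using that by (auto simp: D_def)
  then have "a \<alpha> + (-1) * b \<alpha> = 0"
    by (rule power_series_near_0_zero_unique[OF diff r(1)])
  then show "a \<alpha> = b \<alpha>"
    by simp
qed

lemma generic_eq_refl: "generic_eq UNIV f f"
  unfolding generic_eq_def by (auto intro!: exI[of _ UNIV])

lemma taylor_coeffs_eqI:
  assumes "power_series_near_0 f a"
  shows "taylor_coeffs f = a"
  unfolding taylor_coeffs_def power_series_near_0_def[symmetric]
  using assms power_series_near_0_unique[OF _ _ generic_eq_refl] by (intro the_equality) blast+

lemma analytic_within_power_series_near_0:
  assumes "analytic_within UNIV f 0"
  shows "power_series_near_0 f (taylor_coeffs f)"
proof -
  obtain a where a: "power_series_near_0 f a"
    using assms unfolding analytic_within_def power_series_near_0_def by auto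
  then show ?thesis
    using taylor_coeffs_eqI by blast
qed

lemma power_series_near_0_at_0:
  assumes "power_series_near_0 f a"
  shows "a (\<lambda>_. 0) = f 0"
proof -
  have "((\<lambda>\<alpha>. a \<alpha> * monomial \<alpha> 0) has_sum f 0) UNIV"
    using assms by (auto simp: power_series_near_0_def)
  moreover have "((\<lambda>\<alpha>. a \<alpha> * monomial \<alpha> 0) has_sum a (\<lambda>_. 0)) UNIV"
    by (rule has_sum_finite_neutralI[of "{\<lambda>_. 0}"]) (auto simp: monomial_at_zero)
  ultimately show ?thesis
    using has_sum_unique by blast
qed

section \<open>Exponential sums and integrals over bounded sets\<close>

lemma has_sum_exp: "((\<lambda>n. z ^ n / fact n) has_sum exp z) UNIV" for z :: complex
proof (rule norm_summable_imp_has_sum)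
  show "summable (\<lambda>n. norm (z ^ n / fact n))"
    using summable_norm_exp[of z] by (simp add: scaleR_conv_of_real divide_inverse mult.commute)
  show "(\<lambda>n. z ^ n / fact n) sums exp z"
    using exp_converges[of z] by (simp add: scaleR_conv_of_real divide_inverse mult.commute)
qed

definition multi_fact :: "('n::finite \<Rightarrow> nat) \<Rightarrow> complex" where
  "multi_fact \<alpha> = (\<Prod>i\<in>UNIV. fact (\<alpha> i))"

lemma multi_fact_nonzero [simp]: "multi_fact \<alpha> \<noteq> 0"
  by (simp add: multi_fact_def)

lemma has_sum_exp_dot:
  "((\<lambda>\<alpha>. monomial \<alpha> x / multi_fact \<alpha> * monomial \<alpha> \<xi>) has_sum exp (dot \<xi> x)) UNIV"
proof -
  have "((\<lambda>\<alpha>. \<Prod>i\<in>UNIV. (\<xi> $ i * x $ i) ^ \<alpha> i / fact (\<alpha> i)) has_sum (\<Prod>i\<in>UNIV. exp (\<xi> $ i * x $ i))) UNIV"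
    by (intro has_sum_prod_UNIV has_sum_exp)
  then show ?thesis
    \<comment> \<open>Here \<open>exp_sum\<close> is the library fact that turns the exponential of
      a finite sum into a product, unrelated to the exponential sum of a polyhedron.\<close>
    by (simp add: dot_def exp_sum monomial_def multi_fact_def prod_dividef prod.distrib power_mult_distrib mult.commute)
qed

section \<open>Term-by-term integration of the exponential series\<close>

lemma dot_add_left: "dot (\<xi> + \<eta>) x = dot \<xi> x + dot \<eta> x"
  by (simp add: dot_def distrib_right sum.distrib)

lemma continuous_on_dot [continuous_intros]:
  fixes f :: "'a::topological_space \<Rightarrow> 'b::{comm_ring_1,real_normed_algebra} ^ 'n"
  assumes "continuous_on S f" "continuous_on S g"
  shows "continuous_on S (\<lambda>x. dot (f x) (g x))"
  unfolding dot_def by (intro continuous_intros assms)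

lemma continuous_on_complex_vec [continuous_intros]:
  assumes "continuous_on S f"
  shows "continuous_on S (\<lambda>x. complex_vec (f x))"
  unfolding complex_vec_def by (intro continuous_intros assms)

lemma set_integrable_continuous_compact:
  fixes f :: "'a::euclidean_space \<Rightarrow> complex"
  assumes M: "sets M = sets borel" and K: "compact K" "emeasure M K < \<infinity>"
    and f: "continuous_on UNIV f"
  shows "set_integrable M K f"
proof -
  have "bounded (f ` K)"
    using K f by (intro compact_imp_bounded compact_continuous_image) (auto intro: continuous_on_subset)
  then obtain B where "\<And>x. x \<in> K \<Longrightarrow> norm (f x) \<le> B"
    by (auto simp: bounded_iff)
  moreover have "f \<in> borel_measurable M"
    using borel_measurable_continuous_onI[OF f] M measurable_cong_sets by blast
  moreover have "K \<in> sets M"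
    using K(1) M by (simp add: compact_imp_closed)
  ultimately show ?thesis
    unfolding set_integrable_def using K by (intro integrableI_bounded_set_indicator[of _ _ _ B]) auto
qed

text \<open>The majorants are constant on \<open>K\<close>, so the tail estimate is uniform there
  and the integration error is at most the tail of \<open>b\<close> times
  \<open>measure M K\<close>. This works along the filter of finite index sets, where no sequence of
  partial sums is given.\<close>

lemma has_sum_set_lebesgue_integral:
  fixes f :: "'i \<Rightarrow> 'a \<Rightarrow> complex"
  assumes K: "K \<in> sets M" "emeasure M K < \<infinity>"
    and f: "\<And>\<alpha>. set_integrable M K (f \<alpha>)" and g: "set_integrable M K g"
    and sum: "\<And>x. x \<in> K \<Longrightarrow> ((\<lambda>\<alpha>. f \<alpha> x) has_sum g x) UNIV"
    and bound: "\<And>\<alpha> x. x \<in> K \<Longrightarrow> norm (f \<alpha> x) \<le> b \<alpha>" and b: "b summable_on UNIV"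
  shows "((\<lambda>\<alpha>. LINT x:K|M. f \<alpha> x) has_sum (LINT x:K|M. g x)) UNIV"
proof -
  have tail: "norm ((\<Sum>\<alpha>\<in>G. LINT x:K|M. f \<alpha> x) - (LINT x:K|M. g x))
      \<le> (infsum b UNIV - sum b G) * measure M K" if "finite G" for G
  proof -
    have fG: "set_integrable M K (\<lambda>x. \<Sum>\<alpha>\<in>G. f \<alpha> x)"
      using f by (simp add: set_integrable_def scaleR_sum_right)
    have "(\<Sum>\<alpha>\<in>G. LINT x:K|M. f \<alpha> x) = (LINT x:K|M. \<Sum>\<alpha>\<in>G. f \<alpha> x)"
      using f by (simp add: set_integrable_def set_lebesgue_integral_def scaleR_sum_right)
    then have "norm ((\<Sum>\<alpha>\<in>G. LINT x:K|M. f \<alpha> x) - (LINT x:K|M. g x))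
        = norm (LINT x:K|M. (\<Sum>\<alpha>\<in>G. f \<alpha> x) - g x)"
      using fG g by (simp add: set_integral_diff)
    also have "\<dots> \<le> (LINT x:K|M. norm ((\<Sum>\<alpha>\<in>G. f \<alpha> x) - g x))"
      by (intro set_integral_norm_bound set_integral_diff fG g)
    also have "\<dots> \<le> (LINT x:K|M. infsum b UNIV - sum b G)"
    proof (rule set_integral_mono)
      show "set_integrable M K (\<lambda>x. norm ((\<Sum>\<alpha>\<in>G. f \<alpha> x) - g x))"
        by (intro set_integrable_norm set_integral_diff fG g)
      show "set_integrable M K (\<lambda>x. infsum b UNIV - sum b G)"
        using K by (simp add: set_integrable_def)
      show "norm ((\<Sum>\<alpha>\<in>G. f \<alpha> x) - g x) \<le> infsum b UNIV - sum b G" if "x \<in> K" for x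
        using has_sum_comparison_norm[OF sum[OF that] b bound[OF that] \<open>finite G\<close>]
        by (simp add: norm_minus_commute)
    qed
    also have "\<dots> = (infsum b UNIV - sum b G) * measure M K"
      using K by (simp add: set_lebesgue_integral_def)
    finally show ?thesis .
  qed
  have "((\<lambda>G. (infsum b UNIV - sum b G) * measure M K) \<longlongrightarrow> (infsum b UNIV - infsum b UNIV) * measure M K)
      (finite_subsets_at_top UNIV)"
    using has_sum_infsum[OF b] unfolding has_sum_def by (intro tendsto_intros)
  then have lim: "((\<lambda>G. (infsum b UNIV - sum b G) * measure M K) \<longlongrightarrow> 0) (finite_subsets_at_top UNIV)"
    by simp
  show ?thesis
    unfolding has_sum_def
  proof (rule LIM_zero_cancel, rule Lim_null_comparison[OF _ lim])
    show "\<forall>\<^sub>F G in finite_subsets_at_top UNIV. norm ((\<Sum>\<alpha>\<in>G. LINT x:K|M. f \<alpha> x) - (LINT x:K|M. g x))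
      \<le> (infsum b UNIV - sum b G) * measure M K"
      using tail by (intro eventually_finite_subsets_at_top_weakI)
  qed
qed

text \<open>The centre \<open>p\<close> is arbitrary because analyticity is needed at every point to
  recognise the integral as meromorphic; \<open>p = 0\<close> yields the Taylor
  coefficients.\<close>

lemma has_sum_integral_exp_dot:
  fixes M :: "(real ^ 'n::finite) measure"
  assumes M: "sets M = sets borel" and K: "compact K" "emeasure M K < \<infinity>"
  shows "((\<lambda>\<alpha>. (LINT x:K|M. exp (dot p (complex_vec x)) * monomial \<alpha> (complex_vec x)) / multi_fact \<alpha>
            * monomial \<alpha> (\<xi> - p))
          has_sum (LINT x:K|M. exp (dot \<xi> (complex_vec x)))) UNIV"
proof -
  obtain R where R: "\<And>x. x \<in> K \<Longrightarrow> norm x \<le> R"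
    using compact_imp_bounded[OF K(1)] bounded_iff by blast
  obtain E where E: "\<And>x. x \<in> K \<Longrightarrow> norm (exp (dot p (complex_vec x))) \<le> E"
  proof -
    have "bounded ((\<lambda>x. exp (dot p (complex_vec x))) ` K)"
      by (intro compact_imp_bounded compact_continuous_image K continuous_intros)
    then show thesis
      using that by (auto simp: bounded_iff)
  qed
  define c :: "complex ^ 'n" where "c = (\<chi> i. of_real R)"
  \<comment> \<open>On \<open>K\<close> the exponential at \<open>p\<close> is bounded by
    \<open>E\<close> and the monomials by their values at the corner \<open>c\<close>. What remains
    is the series of \<open>exp (dot (\<xi> - p) c)\<close>, which is absolutely summable.\<close>
  define b where "b \<alpha> = E * norm (monomial \<alpha> c / multi_fact \<alpha> * monomial \<alpha> (\<xi> - p))" for \<alpha>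
  have cont: "continuous_on UNIV (\<lambda>x::real^'n. exp (dot \<eta> (complex_vec x)))" for \<eta>
    by (intro continuous_intros)
  define f where "f \<alpha> x = exp (dot p (complex_vec x)) * (monomial \<alpha> (complex_vec x) / multi_fact \<alpha> * monomial \<alpha> (\<xi> - p))"
    for \<alpha> and x :: "real ^ 'n"
  have "((\<lambda>\<alpha>. LINT x:K|M. f \<alpha> x) has_sum (LINT x:K|M. exp (dot \<xi> (complex_vec x)))) UNIV"
  proof (rule has_sum_set_lebesgue_integral)
    show "K \<in> sets M"
      using K(1) M by (simp add: compact_imp_closed)
    show "set_integrable M K (f \<alpha>)" for \<alpha>
      unfolding f_def by (intro set_integrable_continuous_compact M K continuous_intros) simp
    show "set_integrable M K (\<lambda>x. exp (dot \<xi> (complex_vec x)))"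
      by (intro set_integrable_continuous_compact M K cont)
    show "((\<lambda>\<alpha>. f \<alpha> x) has_sum exp (dot \<xi> (complex_vec x))) UNIV" if "x \<in> K" for x
    proof -
      have "exp (dot \<xi> (complex_vec x)) = exp (dot p (complex_vec x)) * exp (dot (\<xi> - p) (complex_vec x))"
        using dot_add_left[of p "\<xi> - p" "complex_vec x"] by (simp flip: exp_add)
      then show ?thesis
        unfolding f_def using has_sum_cmult_right[OF has_sum_exp_dot] by metis
    qed
    show "norm (f \<alpha> x) \<le> b \<alpha>" if "x \<in> K" for \<alpha> x
    proof -
      have "norm (complex_vec x $ i) \<le> R" for i
        using R[OF that] component_le_norm_cart[of x i] by (simp add: complex_vec_def)
      then have "norm (monomial \<alpha> (complex_vec x)) \<le> norm (monomial \<alpha> c)"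
        unfolding c_def by (rule norm_monomial_le)
      then have "norm (monomial \<alpha> (complex_vec x) / multi_fact \<alpha> * monomial \<alpha> (\<xi> - p))
         \<le> norm (monomial \<alpha> c / multi_fact \<alpha> * monomial \<alpha> (\<xi> - p))"
        unfolding norm_mult norm_divide by (intro mult_right_mono divide_right_mono) auto
      moreover have "0 \<le> E"
        using order_trans[OF norm_ge_zero E[OF that]] .
      ultimately show ?thesis
        unfolding f_def b_def norm_mult[of "exp _"] by (intro mult_mono E that) auto
    qed
    show "b summable_on UNIV"
      unfolding b_def
      by (intro summable_on_cmult_right has_sum_imp_abs_summable_complex[OF has_sum_exp_dot])
  qed (use K in auto)
  moreover have "(LINT x:K|M. f \<alpha> x) =
      (LINT x:K|M. exp (dot p (complex_vec x)) * monomial \<alpha> (complex_vec x)) / multi_fact \<alpha> * monomial \<alpha> (\<xi> - p)" for \<alpha>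
  proof -
    have "f \<alpha> = (\<lambda>x. exp (dot p (complex_vec x)) * monomial \<alpha> (complex_vec x) / multi_fact \<alpha> * monomial \<alpha> (\<xi> - p))"
      by (simp add: f_def fun_eq_iff)
    then show ?thesis
      by (simp only: set_integral_divide_zero set_integral_mult_left)
  qed
  ultimately show ?thesis
    by simp
qed

section \<open>Explicit formulas for exponential sums and integrals\<close>

lemma complexify_UNIV [simp]: "complexify UNIV = UNIV"
proof -
  have "axis i 1 \<in> rat_vec ` UNIV" for i
    by (intro image_eqI[of _ _ "axis i 1"]) (auto simp: rat_vec_def axis_def vec_eq_iff)
  then have "axis i 1 \<in> vec.span (rat_vec ` UNIV)" for i
    by (rule vec.span_base)
  then have "(\<Sum>i\<in>UNIV. (x $ i) *s axis i 1) \<in> complexify UNIV" for x :: "complex ^ 'n"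
    unfolding complexify_def by (intro vec.span_sum vec.span_scale)
  then show ?thesis
    by (auto simp: basis_expansion)
qed

lemma analytic_within_const: "analytic_within A (\<lambda>_. c) p"
proof -
  have "((\<lambda>\<alpha>. (if \<alpha> = (\<lambda>_. 0) then c else 0) * monomial \<alpha> (\<xi> - p)) has_sum c) UNIV" for \<xi>
    by (rule has_sum_finite_neutralI[of "{\<lambda>_. 0}"]) auto
  then show ?thesis
    unfolding analytic_within_def by (auto intro!: exI[of _ "\<lambda>\<alpha>. if \<alpha> = (\<lambda>_. 0) then c else 0"] exI[of _ 1])
qed

lemma entire_in_meromorphic_functions:
  assumes "\<And>p. analytic_within UNIV f p"
  shows "f \<in> meromorphic_functions UNIV"
proof -
  have "\<exists>r>0. \<exists>g h. (\<forall>\<xi>\<in>UNIV \<inter> ball p r. analytic_within UNIV g \<xi> \<and> analytic_within UNIV h \<xi>) \<and>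
          (\<exists>\<xi>\<in>UNIV \<inter> ball p r. h \<xi> \<noteq> 0) \<and> (\<forall>\<xi>\<in>UNIV \<inter> ball p r. h \<xi> \<noteq> 0 \<longrightarrow> f \<xi> = g \<xi> / h \<xi>)" for p
    by (rule exI[of _ 1], intro conjI, simp, rule exI[of _ f], rule exI[of _ "\<lambda>_. 1"])
       (use assms analytic_within_const[of UNIV 1] in \<open>auto intro!: exI[of _ p]\<close>)
  then show ?thesis
    unfolding meromorphic_functions_def using assms by simp
qed

lemma has_sum_sum:
  fixes f :: "'j \<Rightarrow> 'a \<Rightarrow> 'b::{comm_monoid_add,topological_comm_monoid_add}"
  assumes "\<And>j. j \<in> J \<Longrightarrow> (f j has_sum s j) A"
  shows "((\<lambda>x. \<Sum>j\<in>J. f j x) has_sum (\<Sum>j\<in>J. s j)) A"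
  using assms by (induction J rule: infinite_finite_induct) (auto intro!: has_sum_add)

text \<open>A finite sum converges absolutely at every \<open>\<xi>\<close>, so a function meeting
  the description is forced to be this one; only membership in \<open>meromorphic_functions\<close>
  needs an argument.\<close>

lemma exp_sum_finite:
  assumes "finite (P \<inter> quotient_lattice (mat 1))" "\<not> contains_line P"
  shows "exp_sum (mat 1) P = (\<lambda>\<xi>. \<Sum>x \<in> P \<inter> quotient_lattice (mat 1). exp (dot \<xi> (complex_vec (rat_vec x))))"
    (is "_ = ?f")
proof -
  have "((\<lambda>\<alpha>. (\<Sum>x \<in> P \<inter> quotient_lattice (mat 1). exp (dot p (complex_vec (rat_vec x))) * 
          (monomial \<alpha> (complex_vec (rat_vec x)) / multi_fact \<alpha>)) * monomial \<alpha> (\<xi> - p)) has_sum ?f \<xi>) UNIV" for \<xi> p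
  proof -
    have "exp (dot \<xi> x) = exp (dot p x) * exp (dot (\<xi> - p) x)" for x
      using dot_add_left[of p "\<xi> - p" x] by (simp flip: exp_add)
    then show ?thesis
      by (simp only: sum_distrib_right mult.assoc) (intro has_sum_sum has_sum_cmult_right has_sum_exp_dot)
  qed
  then have "analytic_within UNIV ?f p" for p
    unfolding analytic_within_def by (meson zero_less_one)
  then have "?f \<in> meromorphic_functions UNIV"
    by (rule entire_in_meromorphic_functions)
  then show ?thesis
    unfolding exp_sum_def using assms
    by (auto simp: dual_space_mat_1 pairing_mat_1 intro!: the_equality)
qed

lemma power_series_near_0_exp_dot_sum:
  "power_series_near_0 (\<lambda>\<xi>. \<Sum>x\<in>X. exp (dot \<xi> (v x))) (\<lambda>\<alpha>. \<Sum>x\<in>X. monomial \<alpha> (v x) / multi_fact \<alpha>)"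
  unfolding power_series_near_0_def sum_distrib_right
  by (intro exI[of _ 1] conjI ballI has_sum_sum has_sum_exp_dot) simp

text \<open>As for finite sums: integrability at every \<open>\<xi>\<close> fixes the function, and
  the expansions around all \<open>p\<close> show it to be entire.\<close>

lemma exp_integral_compact:
  fixes F :: "(rat ^ 'n::finite) set"
  assumes "compact (real_hull F)" "emeasure (aff_measure (mat 1) F) (real_hull F) < \<infinity>" "\<not> contains_line F"
  shows "exp_integral (mat 1) F = (\<lambda>\<xi>. LINT x:real_hull F|aff_measure (mat 1) F. exp (dot \<xi> (complex_vec x)))"
    (is "_ = ?f")
proof -
  have M: "sets (aff_measure (mat 1) F) = sets borel"
    by (simp add: aff_measure_def Let_def)
  have "analytic_within UNIV ?f p" for p
    unfolding analytic_within_def using has_sum_integral_exp_dot[OF M assms(1,2)] by (meson zero_less_one)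
  then have "?f \<in> meromorphic_functions UNIV"
    by (rule entire_in_meromorphic_functions)
  moreover have "set_integrable (aff_measure (mat 1) F) (real_hull F) (\<lambda>x. exp (dot \<xi> (complex_vec x)))" for \<xi>
    by (intro set_integrable_continuous_compact M assms continuous_intros)
  ultimately show ?thesis
    unfolding exp_integral_def using assms
    by (auto simp: dual_space_mat_1 pairing_mat_1 intro!: the_equality)
qed

lemma power_series_near_0_integral_exp_dot:
  fixes M :: "(real ^ 'n::finite) measure"
  assumes M: "sets M = sets borel" and K: "compact K" "emeasure M K < \<infinity>"
  shows "power_series_near_0 (\<lambda>\<xi>. LINT x:K|M. exp (dot \<xi> (complex_vec x)))
     (\<lambda>\<alpha>. (LINT x:K|M. monomial \<alpha> (complex_vec x)) / multi_fact \<alpha>)"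
  using has_sum_integral_exp_dot[OF assms, of 0]
  by (auto simp: power_series_near_0_def dot_def intro!: exI[of _ 1])

section \<open>Lattice bases and normalized Lebesgue measure\<close>

lemma
  fixes L :: "(rat ^ 'n) set"
  assumes "0 \<in> L" and diff: "\<And>x y. x \<in> L \<Longrightarrow> y \<in> L \<Longrightarrow> x - y \<in> L"
  shows diff_closed_imp_add_closed: "x \<in> L \<Longrightarrow> y \<in> L \<Longrightarrow> x + y \<in> L"
    and diff_closed_imp_int_scale_closed: "x \<in> L \<Longrightarrow> of_int k *s x \<in> L"
proof -
  have uminus: "- x \<in> L" if "x \<in> L" for x
    using diff[OF assms(1) that] by simp
  show add: "x + y \<in> L" if "x \<in> L" "y \<in> L" for x y
    using diff[OF that(1) uminus[OF that(2)]] by simp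
  show "of_int k *s x \<in> L" if "x \<in> L"
  proof (induction k rule: int_induct[where k = 0])
    case base
    show ?case using assms(1) by simp
  next
    case (step1 i)
    then show ?case using add[OF _ \<open>x \<in> L\<close>] by (simp add: vec.scale_left_distrib)
  next
    case (step2 i)
    then show ?case using diff[OF _ \<open>x \<in> L\<close>] by (simp add: vec.scale_left_diff_distrib)
  qed
qed

text \<open>Induction on the coordinates that may be nonzero. The \<open>i\<close>-th coordinates of
  \<open>L\<close> form a subgroup of the integers; if it is nonzero, an element \<open>b\<close>
  attaining its least positive member \<open>d\<close> completes a basis of the subgroup
  \<open>L0\<close> where that coordinate vanishes.\<close>

lemma int_subgroup_has_lattice_basis:
  fixes L :: "(rat ^ 'n::finite) set"
  assumes "finite S" and "0 \<in> L" and "\<And>x y. x \<in> L \<Longrightarrow> y \<in> L \<Longrightarrow> x - y \<in> L"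
    and "\<And>x i. x \<in> L \<Longrightarrow> x $ i \<in> \<int>" and "\<And>x i. x \<in> L \<Longrightarrow> i \<notin> S \<Longrightarrow> x $ i = 0"
  shows "\<exists>B. lattice_basis B L"
  using assms
proof (induction S arbitrary: L rule: finite_induct)
  case empty
  then have "L = {0}"
    by (auto simp: vec_eq_iff)
  then have "lattice_basis {} L"
    by (simp add: lattice_basis_def vec.independent_empty)
  then show ?case ..
next
  case (insert i S)
  note closed = diff_closed_imp_add_closed[OF insert.prems(1,2)] diff_closed_imp_int_scale_closed[OF insert.prems(1,2)]
  define L0 where "L0 = {x \<in> L. x $ i = 0}"
  obtain B0 where B0: "lattice_basis B0 L0"
    using insert.IH[of L0] insert.prems unfolding L0_def by fastforce
  show ?case
  proof (cases "L0 = L")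
    case True
    with B0 show ?thesis by auto
  next
    case False
    define D where "D d \<longleftrightarrow> d > 0 \<and> (\<exists>x\<in>L. x $ i = of_nat d)" for d
    obtain y where y: "y \<in> L" "y $ i \<noteq> 0"
      using False by (auto simp: L0_def)
    obtain z where z: "y $ i = of_int z"
      using insert.prems(3)[OF y(1)] by (auto elim: Ints_cases)
    have "\<exists>d. D d"
    proof (cases "z > 0")
      case True
      then show ?thesis
        using y z by (intro exI[of _ "nat z"]) (auto simp: D_def of_nat_nat intro!: bexI[of _ y])
    next
      case False
      have "0 - y \<in> L"
        by (intro insert.prems y)
      with False show ?thesis
        using y z by (intro exI[of _ "nat (- z)"]) (auto simp: D_def of_nat_nat intro!: bexI[of _ "- y"])
    qed
    then obtain d where d: "D d" "\<And>e. D e \<Longrightarrow> d \<le> e"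
      using ex_has_least_nat[of D _ id] by auto
    then obtain b where b: "b \<in> L" "b $ i = of_nat d" and "d > 0"
      by (auto simp: D_def)
    \<comment> \<open>Independence of \<open>b\<close> from \<open>B0\<close> concerns the rational
      span, not just integer combinations.\<close>
    have span0: "x $ i = 0" if "x \<in> vec.span B0" for x
    proof -
      have "B0 \<subseteq> {x. x $ i = 0}"
      proof
        fix v assume "v \<in> B0"
        \<comment> \<open>That \<open>B0\<close> lies in \<open>L0\<close> is not part of
          \<open>lattice_basis\<close>; indicator coefficients recover it.\<close>
        then have "v = (\<Sum>b\<in>B0. of_int (if b = v then 1 else 0) *s b)"
          using B0 by (simp add: lattice_basis_def if_distrib[of "\<lambda>c. c *s _"] if_distrib[of of_int] cong: if_cong)
        then have "\<exists>c. v = (\<Sum>b\<in>B0. of_int (c b) *s b) \<and> True"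
          by (intro exI[of _ "\<lambda>b. if b = v then 1 else 0"]) simp
        then have "v \<in> L0"
          using B0 unfolding lattice_basis_def by auto
        then show "v \<in> {x. x $ i = 0}"
          by (simp add: L0_def)
      qed
      moreover have "vec.subspace {x :: rat ^ 'n. x $ i = 0}"
        by (auto simp: vec.subspace_def)
      ultimately show ?thesis
        using vec.span_minimal that by blast
    qed
    have b0: "b \<notin> vec.span B0"
      using span0[of b] b \<open>d > 0\<close> by auto
    then have bB0: "b \<notin> B0"
      using vec.span_base by blast
    have "L = {\<Sum>b\<in>insert b B0. of_int (c b) *s b | c. True}"
    proof (intro set_eqI iffI)
      fix x assume x: "x \<in> L"
      obtain w where w: "x $ i = of_int w"
        using insert.prems(3)[OF x] by (auto elim: Ints_cases)
      \<comment> \<open>Division with remainder: a nonzero remainder would be a positive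
        \<open>i\<close>-th coordinate smaller than \<open>d\<close>.\<close>
      define k where "k = w div int d"
      have "x - of_int k *s b \<in> L"
        using closed(2) insert.prems(2) x b(1) by blast
      moreover have "(x - of_int k *s b) $ i = 0"
      proof (rule ccontr)
        have *: "(x - of_int k *s b) $ i = of_nat (nat (w mod int d))"
        proof -
          have "(x - of_int k *s b) $ i = rat_of_int (w - k * int d)"
            using w b(2) by simp
          also have "w - k * int d = w mod int d"
            by (simp add: k_def minus_div_mult_eq_mod)
          also have "rat_of_int \<dots> = of_nat (nat (w mod int d))"
            using \<open>d > 0\<close> by (simp add: of_nat_nat)
          finally show ?thesis .
        qed
        assume "(x - of_int k *s b) $ i \<noteq> 0"
        with * have "D (nat (w mod int d))"
          unfolding D_def using \<open>x - of_int k *s b \<in> L\<close> by (metis of_nat_0 neq0_conv)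
        then have "d \<le> nat (w mod int d)"
          by (rule d)
        moreover have "w mod int d < int d"
          using \<open>d > 0\<close> by simp
        ultimately show False
          using \<open>d > 0\<close> by linarith
      qed
      ultimately have "x - of_int k *s b \<in> L0"
        by (simp add: L0_def)
      then obtain c where "x - of_int k *s b = (\<Sum>b\<in>B0. of_int (c b) *s b)"
        using B0 unfolding lattice_basis_def by auto
      then have "x = of_int k *s b + (\<Sum>b\<in>B0. of_int (c b) *s b)"
        by (simp add: algebra_simps)
      also have "(\<Sum>b\<in>B0. of_int (c b) *s b) = (\<Sum>v\<in>B0. of_int ((c(b := k)) v) *s v)"
        using bB0 by (intro sum.cong) auto
      also have "of_int k *s b + \<dots> = (\<Sum>v\<in>insert b B0. of_int ((c(b := k)) v) *s v)"
        using bB0 B0 by (simp add: lattice_basis_def)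
      finally show "x \<in> {\<Sum>b\<in>insert b B0. of_int (c b) *s b | c. True}"
        by blast
    next
      fix x assume "x \<in> {\<Sum>b\<in>insert b B0. of_int (c b) *s b | c. True}"
      then obtain c where "x = of_int (c b) *s b + (\<Sum>v\<in>B0. of_int (c v) *s v)"
        using bB0 B0 by (auto simp: lattice_basis_def)
      moreover have "(\<Sum>v\<in>B0. of_int (c v) *s v) \<in> L"
        using B0 unfolding lattice_basis_def L0_def by blast
      ultimately show "x \<in> L"
        using closed b(1) by auto
    qed
    then have "lattice_basis (insert b B0) L"
      using B0 b0 by (auto simp: lattice_basis_def vec.independent_insertI)
    then show ?thesis ..
  qed
qed

text \<open>Guarantees that the \<open>SOME B\<close> in \<open>aff_measure\<close> picks a genuine
  basis.\<close>

lemma lattice_basis_lin_exists: "\<exists>B. lattice_basis B (quotient_lattice (mat 1) \<inter> lin F)"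
  by (rule int_subgroup_has_lattice_basis[of UNIV])
     (auto simp: quotient_lattice_mat_1 lin_def vec.span_zero intro!: vec.span_diff)

text \<open>These functionals read off coordinates with respect to \<open>B\<close>, also for real
  coefficients, which bounds the parameters of a bounded set.\<close>

lemma independent_imp_dual_vectors:
  fixes B :: "(rat ^ 'n::finite) set"
  assumes "\<not> vec.dependent B"
  shows "\<exists>\<phi>. \<forall>b\<in>B. \<forall>v\<in>B. dot (\<phi> b) v = (if v = b then 1 else 0)"
proof -
  have "\<exists>\<phi>. \<forall>v\<in>B. dot \<phi> v = (if v = b then 1 else 0)" for b
  proof -
    \<comment> \<open>The functional is encoded as a map with all components equal, so that it has a
      matrix; any row, here the one at \<open>undefined\<close>, represents it.\<close>
    obtain g :: "rat ^ 'n \<Rightarrow> rat ^ 'n" where g: "Vector_Spaces.linear (*s) (*s) g"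
      "\<And>v. v \<in> B \<Longrightarrow> g v = (\<chi> _. if v = b then 1 else 0)"
      using vec.linear_independent_extend[OF assms, of "\<lambda>v. \<chi> _. if v = b then 1 else 0"] by auto
    define \<phi> where "\<phi> = matrix g $ undefined"
    have "dot \<phi> v = g v $ undefined" for v
      using matrix_works[OF g(1), of v] by (auto simp: \<phi>_def dot_def matrix_vector_mult_def vec_eq_iff)
    then show ?thesis
      using g(2) by (intro exI[of _ \<phi>]) simp
  qed
  then show ?thesis
    by metis
qed

lemma dot_rat_vec: "dot (rat_vec a) (rat_vec b) = of_rat (dot a b)"
  by (simp add: dot_def rat_vec_def of_rat_sum of_rat_mult)

lemma dot_eq_inner: "dot x y = x \<bullet> (y :: real ^ 'n)"
  by (simp add: dot_def inner_vec_def)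

text \<open>Each parameter \<open>t b\<close> is the inner product of a fixed dual vector with
  \<open>p t - rat_vec x0\<close>. By Cauchy-Schwarz the preimage of \<open>K\<close> lies in a box,
  whose product measure is finite.\<close>

lemma emeasure_aff_measure_bounded:
  fixes F :: "(rat ^ 'n::finite) set"
  assumes K: "bounded K" "K \<in> sets borel"
  shows "emeasure (aff_measure (mat 1) F) K < \<infinity>"
proof -
  define B where "B = (SOME B. lattice_basis B (quotient_lattice (mat 1) \<inter> lin F))"
  define x0 where "x0 = (SOME x. x \<in> F)"
  have "lattice_basis B (quotient_lattice (mat 1) \<inter> lin F)"
    unfolding B_def using lattice_basis_lin_exists by (rule someI_ex)
  then have B: "finite B" "\<not> vec.dependent B"
    by (auto simp: lattice_basis_def)
  define p :: "_ \<Rightarrow> real ^ 'n" where "p t = rat_vec x0 + (\<Sum>b\<in>B. t b *\<^sub>R rat_vec b)" for t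
  have meas: "p \<in> measurable (\<Pi>\<^sub>M b\<in>B. lborel) borel"
    unfolding p_def by measurable
  have M: "aff_measure (mat 1) F = distr (\<Pi>\<^sub>M b\<in>B. lborel) borel p"
    unfolding aff_measure_def Let_def B_def x0_def p_def ..
  obtain \<phi> where \<phi>: "\<And>b v. b \<in> B \<Longrightarrow> v \<in> B \<Longrightarrow> dot (\<phi> b) v = (if v = b then 1 else 0)"
    using independent_imp_dual_vectors[OF B(2)] by blast
  obtain R where R: "\<And>x. x \<in> K \<Longrightarrow> norm (x - rat_vec x0) \<le> R"
  proof -
    have "bounded ((\<lambda>x. x - rat_vec x0) ` K)"
      by (rule bounded_translation_minus[OF K(1)])
    then show thesis
      using that by (auto simp: bounded_iff)
  qed
  have coord: "t b = rat_vec (\<phi> b) \<bullet> (p t - rat_vec x0)" if "b \<in> B" for t b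
  proof -
    have "rat_vec (\<phi> b) \<bullet> (p t - rat_vec x0) = (\<Sum>v\<in>B. t v * dot (rat_vec (\<phi> b)) (rat_vec v))"
      by (simp add: p_def inner_sum_right dot_eq_inner)
    also have "\<dots> = (\<Sum>v\<in>B. if v = b then t b else 0)"
      using \<phi>[OF that] by (intro sum.cong) (auto simp: dot_rat_vec)
    also have "\<dots> = t b"
      using that B by simp
    finally show ?thesis ..
  qed
  define r where "r b = norm (rat_vec (\<phi> b) :: real ^ 'n) * R" for b
  interpret product_sigma_finite "\<lambda>b :: rat ^ 'n. lborel :: real measure"
    by standard
  have "emeasure (aff_measure (mat 1) F) K = emeasure (\<Pi>\<^sub>M b\<in>B. lborel) (p -` K \<inter> space (\<Pi>\<^sub>M b\<in>B. lborel))"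
    unfolding M using meas K(2) by (rule emeasure_distr)
  also have "\<dots> \<le> emeasure (\<Pi>\<^sub>M b\<in>B. lborel) (PiE B (\<lambda>b. {- r b..r b}))"
  proof (rule emeasure_mono)
    show "PiE B (\<lambda>b. {- r b..r b}) \<in> sets (\<Pi>\<^sub>M b\<in>B. lborel)"
      using B(1) by (intro sets_PiM_I_finite) auto
    show "p -` K \<inter> space (\<Pi>\<^sub>M b\<in>B. lborel) \<subseteq> PiE B (\<lambda>b. {- r b..r b})"
    proof
      fix t assume t: "t \<in> p -` K \<inter> space (\<Pi>\<^sub>M b\<in>B. lborel)"
      have "\<bar>t b\<bar> \<le> r b" if "b \<in> B" for b
      proof -
        have "\<bar>t b\<bar> \<le> norm (rat_vec (\<phi> b) :: real ^ 'n) * norm (p t - rat_vec x0)"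
          using coord[OF that, of t] Cauchy_Schwarz_ineq2 by metis
        also have "\<dots> \<le> r b"
          unfolding r_def using t R by (intro mult_left_mono) auto
        finally show ?thesis .
      qed
      then show "t \<in> PiE B (\<lambda>b. {- r b..r b})"
        using t by (force simp: space_PiM PiE_iff abs_le_iff)
    qed
  qed
  also have "\<dots> = (\<Prod>b\<in>B. emeasure lborel {- r b..r b})"
    using B(1) by (intro emeasure_PiM) auto
  also have "\<dots> < \<infinity>"
    by (auto simp: less_top[symmetric] ennreal_prod_eq_top emeasure_lborel_Icc_eq)
  finally show ?thesis .
qed

section \<open>Consequences of boundedness\<close>

lemma compact_real_hull:
  fixes F :: "(rat ^ 'n::finite) set"
  assumes "\<And>x i. x \<in> F \<Longrightarrow> \<bar>x $ i\<bar> \<le> M"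
  shows "compact (real_hull F)"
proof -
  have "real_hull F = (\<Inter>(a, b) \<in> {(a, b). \<forall>y\<in>F. dot a y \<le> b}. {x. rat_vec a \<bullet> x \<le> of_rat b})"
    by (auto simp: real_hull_def dot_eq_inner)
  then have "closed (real_hull F)"
    by (auto intro!: closed_INT closed_halfspace_le)
  moreover have "bounded (real_hull F)"
  proof -
    have "norm x \<le> (\<Sum>i::'n\<in>UNIV. of_rat M)" if "x \<in> real_hull F" for x
    proof -
      have hull: "dot (rat_vec a) x \<le> of_rat b" if "\<forall>y\<in>F. dot a y \<le> b" for a b
        using \<open>x \<in> real_hull F\<close> that by (auto simp: real_hull_def)
      have "\<bar>x $ i\<bar> \<le> of_rat M" for i
      proof -
        have ax: "dot (axis i c) y = c * y $ i" for c :: "'b::comm_ring_1" and y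
          by (simp add: dot_def axis_def if_distrib[of "\<lambda>c. c * _"] cong: if_cong)
        have rv: "rat_vec (axis i c) = (axis i (of_rat c) :: real ^ 'n)" for c
          by (simp add: rat_vec_def axis_def vec_eq_iff)
        \<comment> \<open>The bounds on \<open>F\<close> are themselves rational inequalities valid
          on \<open>F\<close>, hence among those that define the hull.\<close>
        have "x $ i \<le> of_rat M"
          using hull[of "axis i 1" M] assms by (force simp: ax rv abs_le_iff)
        moreover have "- (x $ i) \<le> of_rat M"
          using hull[of "axis i (- 1)" M] assms by (force simp: ax rv abs_le_iff of_rat_minus)
        ultimately show ?thesis
          by simp
      qed
      then show ?thesis
        using norm_le_l1_cart[of x] sum_mono[of UNIV "\<lambda>i. \<bar>x $ i\<bar>" "\<lambda>_. of_rat M"] by simp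
    qed
    then show ?thesis
      unfolding bounded_iff by blast
  qed
  ultimately show ?thesis
    by (simp add: compact_eq_bounded_closed)
qed

lemma bounded_imp_not_contains_line:
  assumes "\<And>x i. x \<in> F \<Longrightarrow> \<bar>x $ i\<bar> \<le> M"
  shows "\<not> contains_line F"
proof
  assume "contains_line F"
  then obtain x v where v: "v \<noteq> 0" "\<And>t. x + t *s v \<in> F"
    by (auto simp: contains_line_def)
  then obtain i where i: "v $ i \<noteq> 0"
    by (auto simp: vec_eq_iff)
  \<comment> \<open>The parameter is chosen to make the \<open>i\<close>-th coordinate equal to
    \<open>M + 1\<close>.\<close>
  have "\<bar>(x + ((M + 1 - x $ i) / v $ i) *s v) $ i\<bar> \<le> M"
    by (intro assms v)
  then show False
    using i by simp
qed

lemma finite_bounded_lattice_points: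
  fixes P :: "(rat ^ 'n::finite) set"
  assumes "\<And>x i. x \<in> P \<Longrightarrow> \<bar>x $ i\<bar> \<le> M"
  shows "finite (P \<inter> quotient_lattice (mat 1))"
proof -
  define Z where "Z = (of_int :: int \<Rightarrow> rat) ` {- \<lceil>M\<rceil>..\<lceil>M\<rceil>}"
  have "P \<inter> quotient_lattice (mat 1) \<subseteq> vec_lambda ` PiE UNIV (\<lambda>_. Z)"
  proof
    fix x assume x: "x \<in> P \<inter> quotient_lattice (mat 1)"
    have "x $ i \<in> Z" for i
    proof -
      obtain z where z: "x $ i = of_int z"
        using x by (auto simp: quotient_lattice_mat_1 elim: Ints_cases)
      moreover have "\<bar>x $ i\<bar> \<le> M"
        using assms x by auto
      ultimately have "z \<in> {- \<lceil>M\<rceil>..\<lceil>M\<rceil>}"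
        by (auto simp: abs_le_iff) linarith+
      with z show ?thesis
        by (auto simp: Z_def)
    qed
    then show "x \<in> vec_lambda ` PiE UNIV (\<lambda>_. Z)"
      by (intro image_eqI[of _ _ "($) x"]) auto
  qed
  moreover have "finite (vec_lambda ` PiE (UNIV :: 'n set) (\<lambda>_. Z))"
    by (intro finite_imageI finite_PiE) (auto simp: Z_def)
  ultimately show ?thesis
    by (rule finite_subset)
qed

section \<open>Infinite-order operators on polynomials\<close>

text \<open>Exponents are attached to an arbitrary index set and may repeat, so differentiation acts
  termwise without regrouping exponents that become equal.\<close>

definition poly_sum :: "'j set \<Rightarrow> ('j \<Rightarrow> complex) \<Rightarrow> ('j \<Rightarrow> 'n::finite \<Rightarrow> nat) \<Rightarrow> real ^ 'n \<Rightarrow> complex" where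
  "poly_sum J c e = (\<lambda>x. \<Sum>j\<in>J. c j * monomial (e j) (complex_vec x))"

lemma poly_sum_group:
  assumes "finite J"
  shows "\<exists>S d. finite S \<and> poly_sum J c e = poly_sum S d (\<lambda>\<beta>. \<beta>)"
proof (intro exI[of _ "e ` J"] exI[of _ "\<lambda>\<beta>. \<Sum>j | j \<in> J \<and> e j = \<beta>. c j"] conjI ext)
  fix x
  have "poly_sum J c e x = (\<Sum>\<beta>\<in>e ` J. \<Sum>j | j \<in> J \<and> e j = \<beta>. c j * monomial (e j) (complex_vec x))"
    unfolding poly_sum_def by (rule sum.image_gen[OF assms])
  then show "poly_sum J c e x = poly_sum (e ` J) (\<lambda>\<beta>. \<Sum>j | j \<in> J \<and> e j = \<beta>. c j) (\<lambda>\<beta>. \<beta>) x"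
    by (simp add: poly_sum_def sum_distrib_right)
qed (use assms in simp)

definition is_poly_sum :: "(real ^ 'n::finite \<Rightarrow> complex) \<Rightarrow> bool" where
  "is_poly_sum h \<longleftrightarrow> (\<exists>S d. finite S \<and> h = poly_sum S d (\<lambda>\<beta>. \<beta>))"

lemma is_poly_sumI: "finite J \<Longrightarrow> h = poly_sum J c e \<Longrightarrow> is_poly_sum h"
  unfolding is_poly_sum_def using poly_sum_group by blast

lemma is_poly_sum_const: "is_poly_sum (\<lambda>_. a)"
  by (rule is_poly_sumI[of "{()}" _ "\<lambda>_. a" "\<lambda>_ _. 0"]) (auto simp: poly_sum_def)

lemma is_poly_sum_component: "is_poly_sum (\<lambda>x. of_real (x $ i))"
  by (rule is_poly_sumI[of "{()}" _ "\<lambda>_. 1" "\<lambda>_ j. if j = i then 1 else 0"])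
     (auto simp: poly_sum_def monomial_def complex_vec_def if_distrib[of "\<lambda>k. _ ^ k"] cong: if_cong)

lemma is_poly_sum_add:
  assumes "is_poly_sum f" "is_poly_sum g"
  shows "is_poly_sum (\<lambda>x. f x + g x)"
proof -
  obtain S c T d where "finite S" "f = poly_sum S c (\<lambda>\<beta>. \<beta>)" "finite T" "g = poly_sum T d (\<lambda>\<beta>. \<beta>)"
    using assms by (auto simp: is_poly_sum_def)
  then show ?thesis
    by (intro is_poly_sumI[of "S <+> T" _ "case_sum c d" "case_sum (\<lambda>\<beta>. \<beta>) (\<lambda>\<beta>. \<beta>)"])
       (auto simp: poly_sum_def sum.Plus)
qed

lemma is_poly_sum_mult:
  assumes "is_poly_sum f" "is_poly_sum g"
  shows "is_poly_sum (\<lambda>x. f x * g x)"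
proof -
  obtain S c T d where "finite S" "f = poly_sum S c (\<lambda>\<beta>. \<beta>)" "finite T" "g = poly_sum T d (\<lambda>\<beta>. \<beta>)"
    using assms by (auto simp: is_poly_sum_def)
  then show ?thesis
    by (intro is_poly_sumI[of "S \<times> T" _ "\<lambda>(\<beta>, \<gamma>). c \<beta> * d \<gamma>" "\<lambda>(\<beta>, \<gamma>) i. \<beta> i + \<gamma> i"])
       (auto simp: poly_sum_def sum_product sum.cartesian_product monomial_add mult_ac intro!: sum.cong)
qed

lemma is_poly_sum_sum:
  assumes "\<And>j. j \<in> J \<Longrightarrow> is_poly_sum (f j)"
  shows "is_poly_sum (\<lambda>x. \<Sum>j\<in>J. f j x)"
  using assms
  by (induction J rule: infinite_finite_induct) (auto intro: is_poly_sum_const is_poly_sum_add)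

lemma real_polynomial_function_is_poly_sum:
  fixes f :: "real ^ 'n::finite \<Rightarrow> real"
  assumes "real_polynomial_function f"
  shows "is_poly_sum (\<lambda>x. of_real (f x))"
  using assms
proof (induction f rule: real_polynomial_function.induct)
  case (linear f)
  have f: "f x = (\<Sum>i\<in>UNIV. x $ i * f (axis i 1))" for x
  proof -
    have "f x = f (\<Sum>i\<in>UNIV. x $ i *\<^sub>R axis i 1)"
      using basis_expansion[of x] by (simp add: scalar_mult_eq_scaleR)
    then show ?thesis
      using bounded_linear.linear[OF linear] by (simp add: linear_sum linear_scale)
  qed
  have "(\<lambda>x. complex_of_real (f x)) = (\<lambda>x. \<Sum>i\<in>UNIV. of_real (x $ i) * of_real (f (axis i 1)))"
    by (rule ext, subst f) simp
  then show ?case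
    by (simp add: is_poly_sum_sum is_poly_sum_mult is_poly_sum_component is_poly_sum_const)
next
  case (const c)
  show ?case by (rule is_poly_sum_const)
next
  case (add f g)
  then show ?case by (simp add: is_poly_sum_add)
next
  case (mult f g)
  then show ?case by (simp add: is_poly_sum_mult)
qed

lemma polynomial_function_is_poly_sum:
  fixes h :: "real ^ 'n::finite \<Rightarrow> complex"
  assumes "polynomial_function h"
  shows "is_poly_sum h"
proof -
  have "is_poly_sum (\<lambda>x. of_real (Re (h x)) + \<i> * of_real (Im (h x)))"
    using assms bounded_linear_Re bounded_linear_Im unfolding polynomial_function_def o_def
    by (intro is_poly_sum_add is_poly_sum_mult is_poly_sum_const real_polynomial_function_is_poly_sum) auto
  then show ?thesis
    by (simp flip: complex_eq)
qed

text \<open>The falling factorial \<open>r (r - 1) ... (r - k + 1)\<close>, written with factorials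
  to match \<open>multi_fact\<close>.\<close>

definition deriv_coeff :: "nat \<Rightarrow> nat \<Rightarrow> complex" where
  "deriv_coeff r k = (if k \<le> r then fact r / fact (r - k) else 0)"

lemma deriv_coeff_0 [simp]: "deriv_coeff r 0 = 1"
  by (simp add: deriv_coeff_def)

lemma deriv_coeff_Suc: "deriv_coeff r (Suc k) = deriv_coeff r k * of_nat (r - k)"
proof (cases "Suc k \<le> r")
  case True
  then have "r - k = Suc (r - Suc k)"
    by simp
  then show ?thesis
    using True by (simp add: deriv_coeff_def field_simps)
qed (auto simp: deriv_coeff_def)

lemma monomial_split: "monomial \<alpha> \<xi> = (\<xi> $ i) ^ \<alpha> i * monomial (\<alpha>(i := 0)) \<xi>"
proof -
  have "(\<Prod>j\<in>UNIV - {i}. \<xi> $ j ^ \<alpha> j) = (\<Prod>j\<in>UNIV - {i}. \<xi> $ j ^ (\<alpha>(i := 0)) j)"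
    by (intro prod.cong) auto
  then show ?thesis
    unfolding monomial_def by (simp add: prod.remove[of UNIV i])
qed

text \<open>For \<open>e j i = 0\<close> the truncated exponent stays \<open>0\<close>, which is
  harmless because the new coefficient is \<open>0\<close>.\<close>

lemma partial_deriv_poly_sum:
  "partial_deriv i (poly_sum J c e) =
     poly_sum J (\<lambda>j. c j * of_nat (e j i)) (\<lambda>j. (e j)(i := e j i - 1))"
proof
  fix x
  define R where "R j = monomial ((e j)(i := 0)) (complex_vec x)" for j
  \<comment> \<open>The restriction to the line extends to a complex polynomial in \<open>z\<close>,
    so complex differentiation rules apply.\<close>
  define f where "f z = (\<Sum>j\<in>J. c j * ((of_real (x $ i) + z) ^ e j i * R j))" for z
  have "poly_sum J c e (x + t *\<^sub>R axis i 1) = f (of_real t)" for t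
  proof -
    have "monomial (e j) (complex_vec (x + t *\<^sub>R axis i 1)) = (of_real (x $ i) + of_real t) ^ e j i * R j" for j
    proof -
      have "monomial ((e j)(i := 0)) (complex_vec (x + t *\<^sub>R axis i 1)) = R j"
        unfolding monomial_def R_def by (intro prod.cong) (auto simp: complex_vec_def axis_def)
      then show ?thesis
        by (subst monomial_split[of _ _ i]) (simp add: complex_vec_def)
    qed
    then show ?thesis
      by (simp add: poly_sum_def f_def)
  qed
  moreover have "(f has_field_derivative
      (\<Sum>j\<in>J. c j * (of_nat (e j i) * of_real (x $ i) ^ (e j i - 1) * R j))) (at (of_real 0))"
    unfolding f_def by (auto intro!: derivative_eq_intros simp: mult_ac)
  then have "((\<lambda>t. f (of_real t)) has_vector_derivative
      (\<Sum>j\<in>J. c j * (of_nat (e j i) * of_real (x $ i) ^ (e j i - 1) * R j))) (at 0)"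
    by (rule has_vector_derivative_real_field)
  ultimately have "partial_deriv i (poly_sum J c e) x =
      (\<Sum>j\<in>J. c j * (of_nat (e j i) * of_real (x $ i) ^ (e j i - 1) * R j))"
    unfolding partial_deriv_def by (simp add: vector_derivative_at)
  also have "\<dots> = poly_sum J (\<lambda>j. c j * of_nat (e j i)) (\<lambda>j. (e j)(i := e j i - 1)) x"
    unfolding poly_sum_def R_def
    by (intro sum.cong refl, subst (2) monomial_split[of _ _ i]) (simp add: complex_vec_def mult_ac)
  finally show "partial_deriv i (poly_sum J c e) x = \<dots>" .
qed

lemma partial_deriv_funpow_poly_sum:
  "(partial_deriv i ^^ k) (poly_sum J c e) =
     poly_sum J (\<lambda>j. c j * deriv_coeff (e j i) k) (\<lambda>j. (e j)(i := e j i - k))"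
  by (induction k) (simp_all add: partial_deriv_poly_sum deriv_coeff_Suc mult.assoc fun_upd_def cong: if_cong)

lemma fold_partial_deriv_poly_sum:
  assumes "distinct is"
  shows "fold (\<lambda>i. partial_deriv i ^^ \<alpha> i) is (poly_sum J c e) =
     poly_sum J (\<lambda>j. c j * (\<Prod>i\<in>set is. deriv_coeff (e j i) (\<alpha> i)))
       (\<lambda>j i. if i \<in> set is then e j i - \<alpha> i else e j i)"
  using assms
proof (induction "is" arbitrary: c e)
  case (Cons i "is")
  have "(\<Prod>l\<in>set is. deriv_coeff (((e j)(i := e j i - \<alpha> i)) l) (\<alpha> l)) = (\<Prod>l\<in>set is. deriv_coeff (e j l) (\<alpha> l))" for j
    using Cons.prems by (intro prod.cong) auto
  moreover have "(\<lambda>l. if l \<in> set is then ((e j)(i := e j i - \<alpha> i)) l - \<alpha> l else ((e j)(i := e j i - \<alpha> i)) l) =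
      (\<lambda>l. if l \<in> set (i # is) then e j l - \<alpha> l else e j l)" for j
    using Cons.prems by auto
  ultimately show ?case
    using Cons by (simp add: partial_deriv_funpow_poly_sum mult.assoc)
qed simp

text \<open>The list chosen by \<open>SOME\<close> enters the result only through its set, so its
  order disappears.\<close>

lemma mixed_deriv_poly_sum:
  fixes \<alpha> :: "'n::finite \<Rightarrow> nat"
  shows "mixed_deriv \<alpha> (poly_sum J c e) =
     poly_sum J (\<lambda>j. c j * (\<Prod>i\<in>UNIV. deriv_coeff (e j i) (\<alpha> i))) (\<lambda>j i. e j i - \<alpha> i)"
proof -
  have "\<exists>is. distinct is \<and> set is = (UNIV :: 'n set)"
    using finite_distinct_list[of "UNIV :: 'n set"] by auto
  then have "distinct (SOME is. distinct is \<and> set is = (UNIV :: 'n set))"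
    "set (SOME is. distinct is \<and> set is = (UNIV :: 'n set)) = UNIV"
    using someI_ex by (metis (mono_tags, lifting))+
  then show ?thesis
    unfolding mixed_deriv_def by (simp add: fold_partial_deriv_poly_sum)
qed

lemma prod_deriv_coeff:
  "(\<Prod>i\<in>UNIV. deriv_coeff (\<beta> i) (\<alpha> i)) =
     (if \<alpha> \<le> \<beta> then multi_fact \<beta> / multi_fact (\<lambda>i. \<beta> i - \<alpha> i) else 0)"
  by (auto simp: deriv_coeff_def multi_fact_def le_fun_def prod_dividef)

text \<open>Applied to the monomial of index \<open>\<beta>\<close>, the operator gives
  \<open>multi_fact \<beta>\<close> times the \<open>\<beta>\<close>-th coefficient of the formal
  product of the Taylor series of \<open>f\<close> with \<open>exp (dot \<xi> x)\<close>. Only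
  \<open>\<alpha> \<le> \<beta>\<close> contribute, so convergence is no issue.\<close>

lemma diff_op_poly_sum:
  "diff_op f (poly_sum S c (\<lambda>\<beta>. \<beta>)) x =
     (\<Sum>\<beta>\<in>S. c \<beta> * multi_fact \<beta> *
        cauchy_product (taylor_coeffs f) (\<lambda>\<gamma>. monomial \<gamma> (complex_vec x) / multi_fact \<gamma>) \<beta>)"
proof -
  let ?t = "taylor_coeffs f"
  define g where "g \<alpha> \<beta> = c \<beta> * multi_fact \<beta> *
      (?t \<alpha> * (monomial (\<lambda>i. \<beta> i - \<alpha> i) (complex_vec x) / multi_fact (\<lambda>i. \<beta> i - \<alpha> i)))" for \<alpha> \<beta>
  have "?t \<alpha> * mixed_deriv \<alpha> (poly_sum S c (\<lambda>\<beta>. \<beta>)) x = (\<Sum>\<beta>\<in>S. if \<alpha> \<le> \<beta> then g \<alpha> \<beta> else 0)" for \<alpha>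
    unfolding mixed_deriv_poly_sum prod_deriv_coeff unfolding poly_sum_def g_def sum_distrib_left
    by (intro sum.cong) auto
  moreover have "((\<lambda>\<alpha>. \<Sum>\<beta>\<in>S. if \<alpha> \<le> \<beta> then g \<alpha> \<beta> else 0) has_sum (\<Sum>\<beta>\<in>S. \<Sum>\<alpha> | \<alpha> \<le> \<beta>. g \<alpha> \<beta>)) UNIV"
  proof (rule has_sum_sum)
    fix \<beta>
    show "((\<lambda>\<alpha>. if \<alpha> \<le> \<beta> then g \<alpha> \<beta> else 0) has_sum (\<Sum>\<alpha> | \<alpha> \<le> \<beta>. g \<alpha> \<beta>)) UNIV"
      by (rule has_sum_finite_neutralI[OF finite_multi_index_atMost[of \<beta>]]) auto
  qed
  ultimately show ?thesis
    unfolding diff_op_def by (simp add: infsumI cauchy_product_def g_def sum_distrib_left)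
qed

text \<open>The Cauchy product is a finite sum, linear in its second factor, so integration passes
  to the coefficients of the exponential.\<close>

lemma set_integral_diff_op_poly_sum:
  fixes M :: "(real ^ 'n::finite) measure"
  assumes M: "sets M = sets borel" and K: "compact K" "emeasure M K < \<infinity>"
  shows "(LINT x:K|M. diff_op f (poly_sum S c (\<lambda>\<beta>. \<beta>)) x) =
     (\<Sum>\<beta>\<in>S. c \<beta> * multi_fact \<beta> * cauchy_product (taylor_coeffs f)
        (\<lambda>\<gamma>. (LINT x:K|M. monomial \<gamma> (complex_vec x)) / multi_fact \<gamma>) \<beta>)"
proof -
  have sum: "(LINT x:K|M. \<Sum>a\<in>A. g a x) = (\<Sum>a\<in>A. LINT x:K|M. g a x)"
    if "\<And>a. continuous_on UNIV (g a)" for A and g :: "'i \<Rightarrow> real ^ 'n \<Rightarrow> complex"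
    using set_integrable_continuous_compact[OF M K that]
    by (simp add: set_integrable_def set_lebesgue_integral_def scaleR_sum_right)
  show ?thesis
    unfolding diff_op_poly_sum cauchy_product_def
    by (simp add: sum continuous_intros)
qed

section \<open>Comparison of Taylor coefficients\<close>

lemma face_subset: "F \<in> faces P \<Longrightarrow> F \<subseteq> P"
  by (auto simp: faces_def)

theorem theorem2:
  fixes \<Psi> :: "'n::finite complement_map"
    and \<mu> :: "(rat ^ 'n) set \<Rightarrow> complex ^ 'n \<Rightarrow> complex"
    and P :: "(rat ^ 'n) set"
    and h :: "real ^ 'n \<Rightarrow> complex"
  assumes "rigid_complement_map \<Psi>"
    and "compatible_interpolator \<Psi> \<mu>"
    and "\<forall>K \<in> generic_cones (mat 1) \<Psi>. analytic_within UNIV (\<mu> K) 0"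
    and "rat_polytope (mat 1) P"
    and "generic_polyhedron (mat 1) \<Psi> P"
    and "polynomial_function h"
  shows "(\<Sum>x \<in> P \<inter> quotient_lattice (mat 1). h (rat_vec x)) =
           (\<Sum>F \<in> faces P. LINT x:real_hull F|aff_measure (mat 1) F. diff_op (\<mu> (Supp P F)) h x) \<and>
         of_nat (card (P \<inter> quotient_lattice (mat 1))) =
           (\<Sum>F \<in> faces P. \<mu> (Supp P F) 0 * of_real (vol F))"
proof -
  define \<Lambda> where "\<Lambda> = P \<inter> quotient_lattice (mat 1)"
  define t where "t F = taylor_coeffs (\<mu> (Supp P F))" for F
  define I where "I F \<gamma> = (LINT x:real_hull F|aff_measure (mat 1) F. monomial \<gamma> (complex_vec x)) / multi_fact \<gamma>"
    for F :: "(rat ^ 'n) set" and \<gamma>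
  obtain M where M: "\<And>x i. x \<in> P \<Longrightarrow> \<bar>x $ i\<bar> \<le> M"
    using assms(4) by (auto simp: rat_polytope_def)
  have face_bound: "\<bar>x $ i\<bar> \<le> M" if "F \<in> faces P" "x \<in> F" for F x i
    using M face_subset that by blast
  have sets: "sets (aff_measure (mat 1) F) = sets borel" for F :: "(rat ^ 'n) set"
    by (simp add: aff_measure_def Let_def)
  have compact: "compact (real_hull F)" if "F \<in> faces P" for F
    by (rule compact_real_hull[OF face_bound[OF that]])
  have finite_measure: "emeasure (aff_measure (mat 1) F) (real_hull F) < \<infinity>" if "F \<in> faces P" for F
    using compact[OF that]
    by (intro emeasure_aff_measure_bounded) (auto simp: compact_imp_bounded compact_imp_closed)
  have \<mu>: "power_series_near_0 (\<mu> (Supp P F)) (t F)" if "F \<in> faces P" for F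
    unfolding t_def
    by (rule analytic_within_power_series_near_0)
       (use assms(3,5) that in \<open>auto simp: generic_polyhedron_def\<close>)
  have "power_series_near_0 (exp_integral (mat 1) F) (I F)" if "F \<in> faces P" for F
    unfolding I_def
    using exp_integral_compact[OF compact[OF that] finite_measure[OF that]
        bounded_imp_not_contains_line[OF face_bound[OF that]]]
      power_series_near_0_integral_exp_dot[OF sets compact[OF that] finite_measure[OF that]] by simp
  then have rhs: "power_series_near_0 (\<lambda>\<xi>. \<Sum>F\<in>faces P. \<mu> (Supp P F) \<xi> * exp_integral (mat 1) F \<xi>)
      (\<lambda>\<beta>. \<Sum>F\<in>faces P. cauchy_product (t F) (I F) \<beta>)"
    by (intro power_series_near_0_sum power_series_near_0_mult \<mu>)
  have lhs: "power_series_near_0 (exp_sum (mat 1) P)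
      (\<lambda>\<beta>. \<Sum>x\<in>\<Lambda>. monomial \<beta> (complex_vec (rat_vec x)) / multi_fact \<beta>)"
    using exp_sum_finite[OF finite_bounded_lattice_points[OF M] bounded_imp_not_contains_line[OF M]]
    by (simp add: \<Lambda>_def power_series_near_0_exp_dot_sum)
  have "generic_eq UNIV (exp_sum (mat 1) P) (\<lambda>\<xi>. \<Sum>F\<in>faces P. \<mu> (Supp P F) \<xi> * exp_integral (mat 1) F \<xi>)"
    using assms(2,5) by (simp add: compatible_interpolator_def interpolator_on_def dual_space_mat_1)
  from power_series_near_0_unique[OF lhs rhs this]
  have coeff: "(\<Sum>x\<in>\<Lambda>. monomial \<beta> (complex_vec (rat_vec x)) / multi_fact \<beta>) =
      (\<Sum>F\<in>faces P. cauchy_product (t F) (I F) \<beta>)" for \<beta>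
    by (rule fun_cong)
  have integral: "(LINT x:real_hull F|aff_measure (mat 1) F. diff_op (\<mu> (Supp P F)) (poly_sum S c (\<lambda>\<beta>. \<beta>)) x)
      = (\<Sum>\<beta>\<in>S. c \<beta> * multi_fact \<beta> * cauchy_product (t F) (I F) \<beta>)" if "F \<in> faces P" for F S c
    unfolding t_def I_def by (rule set_integral_diff_op_poly_sum[OF sets compact[OF that] finite_measure[OF that]])
  \<comment> \<open>Stated for a fresh \<open>h\<close>, as it is applied both to the given
    polynomial and to the constant \<open>1\<close>.\<close>
  have main: "(\<Sum>x\<in>\<Lambda>. h (rat_vec x)) =
      (\<Sum>F\<in>faces P. LINT x:real_hull F|aff_measure (mat 1) F. diff_op (\<mu> (Supp P F)) h x)"
    if "h = poly_sum S c (\<lambda>\<beta>. \<beta>)" for h S c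
  proof -
    have "(\<Sum>x\<in>\<Lambda>. h (rat_vec x)) =
        (\<Sum>\<beta>\<in>S. c \<beta> * multi_fact \<beta> * (\<Sum>x\<in>\<Lambda>. monomial \<beta> (complex_vec (rat_vec x)) / multi_fact \<beta>))"
      unfolding that poly_sum_def by (subst sum.swap) (simp add: sum_distrib_left)
    also have "\<dots> = (\<Sum>F\<in>faces P. \<Sum>\<beta>\<in>S. c \<beta> * multi_fact \<beta> * cauchy_product (t F) (I F) \<beta>)"
      unfolding coeff sum_distrib_left by (rule sum.swap)
    also have "\<dots> = (\<Sum>F\<in>faces P. LINT x:real_hull F|aff_measure (mat 1) F. diff_op (\<mu> (Supp P F)) h x)"
      unfolding that by (intro sum.cong refl integral[symmetric])
    finally show ?thesis .
  qed
  \<comment> \<open>With \<open>\<beta> = 0\<close> the Cauchy product has a single term: the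
    constant coefficient of \<open>\<mu> (Supp P F)\<close> times the total mass of
    \<open>F\<close>.\<close>
  have one: "(\<lambda>_. 1) = poly_sum {\<lambda>_. 0} (\<lambda>_. 1) (\<lambda>\<beta>. \<beta> :: 'n \<Rightarrow> nat)"
    by (simp add: poly_sum_def)
  have "(LINT x:real_hull F|aff_measure (mat 1) F. diff_op (\<mu> (Supp P F)) (\<lambda>_. 1) x) =
      \<mu> (Supp P F) 0 * of_real (vol F)" if "F \<in> faces P" for F
  proof -
    have zero: "{\<alpha>. \<alpha> \<le> (\<lambda>_. 0 :: nat)} = {\<lambda>_ :: 'n. 0}"
      by (auto simp: le_fun_def)
    have "(LINT x:real_hull F|aff_measure (mat 1) F. (1 :: complex)) = of_real (vol F)"
      using finite_measure[OF that] compact[OF that] sets[of F]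
      by (simp add: set_lebesgue_integral_def vol_def compact_imp_closed of_real_def)
    then have I0: "I F (\<lambda>_. 0) = of_real (vol F)"
      by (simp add: I_def multi_fact_def)
    show ?thesis
      unfolding one integral[OF that] cauchy_product_def
      using power_series_near_0_at_0[OF \<mu>[OF that]] by (simp add: zero I0 multi_fact_def)
  qed
  then have "of_nat (card \<Lambda>) = (\<Sum>F \<in> faces P. \<mu> (Supp P F) 0 * of_real (vol F))"
    using main[OF one] by simp
  moreover obtain S c where "h = poly_sum S c (\<lambda>\<beta>. \<beta>)"
    using polynomial_function_is_poly_sum[OF assms(6)] by (auto simp: is_poly_sum_def)
  ultimately show ?thesis
    using main unfolding \<Lambda>_def by blast
qed

end
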